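(* Let $(X,\mu)$ be a standard $\sigma$-finite measured space and $V = (V_x)_{x \in X}$ a family of (nonempty) Polish spaces. Assume that $V$ is a standard Borel space such that $\pi : V \to X$ is a Borel map. Assume that the following holds. 1. There exists a Borel map $d : V \times_\pi V \to [0,+\infty)$ such that for every $x \in X$, the restriction of $d$ to $V_x \times V_x$ is a separable complete metric that induces the topology on $V_x$. 2. There exists a sequence of Borel sets $U_n \subset V$ such that for every $x \in X$, the set $\{U_n \cap V_x \mid n \in \mathbb{N}\}$ is a basis for the topology on $V_x$. Then $V$ is a measured field of Polish spaces. In particular, if $V = (V_x)_{x \in X}$ is a measured field of Polish spaces and $W = (W_x)_{x \in X}$ is a family of nonempty closed subsets $W_x \subset V_x$ such that $W \subset V$ is a Borel set, then $(W_x)_{x \in X}$ (with the restricted Borel structure) is a measured field of Polish spaces.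
   Context: Conventions. A standard Borel space is a measurable space isomorphic to a Borel subset of a Polish space. A standard $\sigma$-finite measured space is a standard Borel space with a $\sigma$-finite measure on its Borel $\sigma$-algebra. Product spaces carry the product $\sigma$-algebra and subsets the restricted $\sigma$-algebra. For a family of sets $V = (V_x)_{x\in X}$, the symbol $V$ also denotes the disjoint union of the $V_x$, and $\pi : V \to X$ is the map with $\pi(v) = x$ for $v \in V_x$. $V \times_\pi V = \{(v,w) \in V \times V \mid \pi(v)=\pi(w)\}$. A section is a map $\varphi : X \to V$ with $\varphi(x)\in V_x$ for all $x$. A sequence of Borel sections $\varphi_n : X \to V$ is dense if $\{\varphi_n(x) \mid n\in\mathbb{N}\}$ is dense in $V_x$ for every $x\in X$. A Borel field of Polish spaces consists of a standard Borel space $X$, a family $V=(V_x)_{x\in X}$ of Polish spaces and a standard Borel structure on $V$ such that: (1) $\pi : V\to X$ is Borel; (2) there is a Borel map $d : V\times_\pi V\to[0,+\infty)$ whose restriction to each $V_x\times V_x$ is a separable complete metric inducing the topology of $V_x$; (3) there is a dense sequence of Borel sections $X\to V$. A measured field of Polish spaces consists of a standard $\sigma$-finite measured space $(X,\mu)$, a family $V=(V_x)_{x\in X}$ of Polish spaces and a standard Borel structure on $V$ such that $\pi : V \to X$ is Borel and there exists a Borel set $X_0\subset X$ with $\mu(X\setminus X_0)=0$ such that the restriction $(V_x)_{x\in X_0}=\pi^{-1}(X_0)$ is a Borel field of Polish spaces. *)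

theory Defs
  imports "HOL-Analysis.Analysis"
begin

text \<open>The library type class of Polish spaces only covers spaces whose carrier is a whole type;
  here topologies on arbitrary carriers are needed.\<close>

definition polish_topology :: "'a topology \<Rightarrow> bool" where
  "polish_topology T \<longleftrightarrow> completely_metrizable_space T \<and> separable_space T"

definition borel_of :: "'a topology \<Rightarrow> 'a measure" where
  "borel_of T = sigma (topspace T) {U. openin T U}"

definition measurable_isomorphic :: "'a measure \<Rightarrow> 'b measure \<Rightarrow> bool" where
  "measurable_isomorphic M N \<longleftrightarrow>
     (\<exists>f g. f \<in> M \<rightarrow>\<^sub>M N \<and> g \<in> N \<rightarrow>\<^sub>M M \<and>
        (\<forall>x\<in>space M. g (f x) = x) \<and> (\<forall>y\<in>space N. f (g y) = y))"

text \<open>Standard Borel spaces are measurable spaces; the values of the measure are ignored.  One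
  cannot quantify over the type carrying the Polish space, but \<^typ>\<open>real\<close> is enough: a Polish space
  has at most continuum many points, so it is homeomorphic to a topology (in general unrelated to
  the usual one) on a subset of \<^typ>\<open>real\<close>.\<close>

definition standard_borel :: "'a measure \<Rightarrow> bool" where
  "standard_borel M \<longleftrightarrow>
     (\<exists>(P :: real topology) B. polish_topology P \<and> B \<in> sets (borel_of P) \<and>
        measurable_isomorphic M (restrict_space (borel_of P) B))"

text \<open>A family \<open>(V\<^sub>x)\<close> of topological spaces indexed by \<open>space X\<close> is a function \<open>T\<close> with
  \<open>T x\<close> the topology of \<open>V\<^sub>x = topspace (T x)\<close>.  The disjoint union of the \<open>V\<^sub>x\<close> is the set of pairs
  \<open>(x, v)\<close> with \<open>v \<in> V\<^sub>x\<close>, so that \<open>\<pi>\<close> is \<^const>\<open>fst\<close>.  The measurable space \<open>V\<close> is the Borel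
  structure on this disjoint union.\<close>

definition standard_borel_family ::
    "'x measure \<Rightarrow> ('x \<Rightarrow> 'v topology) \<Rightarrow> ('x \<times> 'v) measure \<Rightarrow> bool" where
  "standard_borel_family X T V \<longleftrightarrow>
     (\<forall>x\<in>space X. polish_topology (T x)) \<and>
     space V = (SIGMA x:space X. topspace (T x)) \<and>
     standard_borel V \<and> fst \<in> V \<rightarrow>\<^sub>M X"

text \<open>The restricted space is \<open>V \<times>\<^sub>\<pi> V\<close>.  The locale \<^locale>\<open>Metric_space\<close> also asks for nonnegativity and
  symmetry outside of the carrier.  This is harmless, as \<open>d\<close> is only ever used
  existentially and may be set to \<open>0\<close> there.\<close>

definition borel_fibre_metric ::
    "'x measure \<Rightarrow> ('x \<Rightarrow> 'v topology) \<Rightarrow> ('x \<times> 'v) measure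
      \<Rightarrow> ('x \<times> 'v \<Rightarrow> 'x \<times> 'v \<Rightarrow> real) \<Rightarrow> bool" where
  "borel_fibre_metric X T V d \<longleftrightarrow>
     (\<lambda>(v, w). d v w) \<in> borel_measurable (restrict_space (V \<Otimes>\<^sub>M V) {(v, w). fst v = fst w}) \<and>
     (\<forall>x\<in>space X.
        let V\<^sub>x = topspace (T x); d\<^sub>x = (\<lambda>v w. d (x, v) (x, w)) in
          Metric_space V\<^sub>x d\<^sub>x \<and> Metric_space.mcomplete V\<^sub>x d\<^sub>x \<and>
          separable_space (Metric_space.mtopology V\<^sub>x d\<^sub>x) \<and>
          Metric_space.mtopology V\<^sub>x d\<^sub>x = T x)"

text \<open>A section is given by its second component; that its value at \<open>x\<close> lies in \<open>V\<^sub>x\<close> is part of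
  measurability into \<open>V\<close>.\<close>

definition dense_borel_sections ::
    "'x measure \<Rightarrow> ('x \<Rightarrow> 'v topology) \<Rightarrow> ('x \<times> 'v) measure \<Rightarrow> (nat \<Rightarrow> 'x \<Rightarrow> 'v) \<Rightarrow> bool" where
  "dense_borel_sections X T V \<phi> \<longleftrightarrow>
     (\<forall>n. (\<lambda>x. (x, \<phi> n x)) \<in> X \<rightarrow>\<^sub>M V) \<and>
     (\<forall>x\<in>space X. T x closure_of range (\<lambda>n. \<phi> n x) = topspace (T x))"

definition borel_field_polish ::
    "'x measure \<Rightarrow> ('x \<Rightarrow> 'v topology) \<Rightarrow> ('x \<times> 'v) measure \<Rightarrow> bool" where
  "borel_field_polish X T V \<longleftrightarrow>
     standard_borel X \<and> standard_borel_family X T V \<and>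
     (\<exists>d. borel_fibre_metric X T V d) \<and> (\<exists>\<phi>. dense_borel_sections X T V \<phi>)"

definition measured_field_polish ::
    "'x measure \<Rightarrow> ('x \<Rightarrow> 'v topology) \<Rightarrow> ('x \<times> 'v) measure \<Rightarrow> bool" where
  "measured_field_polish X T V \<longleftrightarrow>
     standard_borel X \<and> sigma_finite_measure X \<and> standard_borel_family X T V \<and>
     (\<exists>X\<^sub>0\<in>sets X. emeasure X (space X - X\<^sub>0) = 0 \<and>
        borel_field_polish (restrict_space X X\<^sub>0) T (restrict_space V (fst -` X\<^sub>0)))"

end

theory Submission
  imports Defs
begin

text \<open>
  The projection of a Borel set \<open>U \<subseteq> V\<close> to \<open>X\<close> is analytic, so it differs by a null set from a Borel set
  on which \<open>U\<close> has a Borel section (Jankov--von Neumann).  Applying this to the sets \<open>U\<^sub>n\<close> of a fibrewise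
  base, and filling up with a section of \<open>V\<close> where \<open>U\<^sub>n\<close> has an empty fibre, yields sections that are
  dense over a conull Borel set.  For closed subfamilies, the balls around the given dense sections of
  \<open>V\<close>, intersected with \<open>W\<close>, play the role of the sets \<open>U\<^sub>n\<close>.

  The selection theorem needs no topology on \<open>X\<close>.  Since \<open>V\<close> is a measurable image of a measurable
  subset of the Baire space \<open>\<nat> \<rightarrow> \<nat>\<close>, it suffices to uniformise measurable subsets of \<open>X \<times> (\<nat> \<rightarrow> \<nat>)\<close>.
  These are projections of countable intersections of conditions depending on finitely many coordinates,
  which reduces the problem to Suslin schemes of measurable sets.  There, outer measure is approximated
  by the branches below a fixed \<open>\<beta>\<close>; by compactness those form a measurable set, on which the leftmost
  branch is a measurable selector.
\<close>

section \<open>Selection for Suslin schemes\<close>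

text \<open>The next entry may depend on the whole finite sequence chosen so far. The construction
  serves twice: for the bounds \<beta> in the approximation of outer measure, and for the leftmost
  branch.\<close>

primrec greedy_path :: "('a list \<Rightarrow> 'a) \<Rightarrow> nat \<Rightarrow> 'a list" where
  "greedy_path f 0 = []"
| "greedy_path f (Suc n) = greedy_path f n @ [f (greedy_path f n)]"

lemma greedy_path_eq_map: "greedy_path f n = map (\<lambda>i. f (greedy_path f i)) [0..<n]"
  by (induction n) auto

lemma greedy_path_invariant:
  assumes "P []" and "\<And>s. P s \<Longrightarrow> P (s @ [f s])"
  shows "P (greedy_path f n)"
  by (induction n) (use assms in auto)

definition suslin :: "(nat list \<Rightarrow> 'a set) \<Rightarrow> 'a set" where
  "suslin A = {x. \<exists>z. \<forall>n. x \<in> A (map z [0..<n])}"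

text \<open>Membership in a tree of sequences bounded by \<open>\<beta>\<close> that has extensions of every finite length; since the
  tree is finitely branching, this amounts to lying on an infinite branch.\<close>

definition extendible :: "(nat list \<Rightarrow> 'a set) \<Rightarrow> (nat \<Rightarrow> nat) \<Rightarrow> 'a \<Rightarrow> nat list \<Rightarrow> bool" where
  "extendible A \<beta> x s \<longleftrightarrow>
     (\<forall>n. \<exists>t. length t = n \<and> (\<forall>i<n. t ! i \<le> \<beta> (length s + i)) \<and>
        (\<forall>k\<le>length s + n. x \<in> A (take k (s @ t))))"

text \<open>Taking the least admissible entry, rather than an arbitrary one, is what makes the
  branch depend measurably on \<open>x\<close>.\<close>

definition leftmost_step :: "(nat list \<Rightarrow> 'a set) \<Rightarrow> (nat \<Rightarrow> nat) \<Rightarrow> 'a \<Rightarrow> nat list \<Rightarrow> nat" where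
  "leftmost_step A \<beta> x s = (LEAST j. extendible A \<beta> x (s @ [j]))"

definition leftmost_branch :: "(nat list \<Rightarrow> 'a set) \<Rightarrow> (nat \<Rightarrow> nat) \<Rightarrow> 'a \<Rightarrow> nat \<Rightarrow> nat" where
  "leftmost_branch A \<beta> x i = leftmost_step A \<beta> x (greedy_path (leftmost_step A \<beta> x) i)"

text \<open>Koenig's lemma: the extensions of length \<open>Suc n\<close> have first entries bounded
  by \<open>\<beta> (length s)\<close>, so one value \<open>j m\<close> occurs for infinitely many
  \<open>n\<close>. Truncating those extensions yields extensions of \<open>s @ [j m]\<close> of
  every length.\<close>

lemma extendible_step:
  assumes "extendible A \<beta> x s"
  shows "\<exists>j. extendible A \<beta> x (s @ [j])"
proof -
  define good where "good n j t \<longleftrightarrow> j \<le> \<beta> (length s) \<and> length t = n \<and>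
      (\<forall>i<n. t ! i \<le> \<beta> (Suc (length s) + i)) \<and>
      (\<forall>k\<le>Suc (length s) + n. x \<in> A (take k (s @ j # t)))" for n j t
  have "\<exists>j t. good n j t" for n
  proof -
    obtain t where t: "length t = Suc n" "\<And>i. i < Suc n \<Longrightarrow> t ! i \<le> \<beta> (length s + i)"
        "\<forall>k\<le>length s + Suc n. x \<in> A (take k (s @ t))"
      using assms unfolding extendible_def by blast
    obtain j u where "t = j # u"
      using t(1) by (cases t) auto
    with t t(2)[of 0] t(2)[of "Suc _"] show ?thesis
      unfolding good_def by (intro exI[of _ j] exI[of _ u]) auto
  qed
  then obtain j t where "\<And>n. good n (j n) (t n)"
    by metis
  then have jt: "j n \<le> \<beta> (length s)" "length (t n) = n"
      "i < n \<Longrightarrow> t n ! i \<le> \<beta> (Suc (length s) + i)"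
      "k \<le> Suc (length s) + n \<Longrightarrow> x \<in> A (take k (s @ j n # t n))" for n i k
    unfolding good_def by auto
  have "finite (range j)"
    using jt(1) by (auto simp: finite_nat_iff_bounded_le)
  then obtain m where "infinite {n \<in> UNIV. j n = j m}"
    using pigeonhole_infinite[OF infinite_UNIV_nat] by blast
  have "extendible A \<beta> x (s @ [j m])"
    unfolding extendible_def
  proof
    fix n
    \<comment> \<open>An extension of some length \<open>n' \<ge> n\<close> with the right first
      entry is cut down to length \<open>n\<close>.\<close>
    obtain n' where n': "n' \<ge> n" "j n' = j m"
      using \<open>infinite _\<close> unfolding infinite_nat_iff_unbounded_le by blast
    have "take k ((s @ [j m]) @ take n (t n')) = take k (s @ j n' # t n')"
      if "k \<le> length (s @ [j m]) + n" for k
      using that n' jt(2)[of n'] by (auto simp: take_Cons' min_def)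
    with n' jt(4)[of _ n']
    have "\<forall>k\<le>length (s @ [j m]) + n. x \<in> A (take k ((s @ [j m]) @ take n (t n')))"
      by simp
    moreover have "length (take n (t n')) = n" "\<forall>i<n. take n (t n') ! i \<le> \<beta> (length (s @ [j m]) + i)"
      using n' jt(2)[of n'] jt(3)[of _ n'] by auto
    ultimately show "\<exists>u. length u = n \<and> (\<forall>i<n. u ! i \<le> \<beta> (length (s @ [j m]) + i)) \<and>
        (\<forall>k\<le>length (s @ [j m]) + n. x \<in> A (take k ((s @ [j m]) @ u)))"
      by blast
  qed
  then show ?thesis ..
qed

text \<open>Extendibility propagates from \<open>[]\<close> along the greedy path by
  \<open>extendible_step\<close>. The case of an empty extension in \<open>extendible\<close> then
  gives membership in \<open>A\<close> at each node.\<close>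

lemma leftmost_branch_mem:
  assumes "extendible A \<beta> x []"
  shows "x \<in> A (map (leftmost_branch A \<beta> x) [0..<n])"
proof -
  have "extendible A \<beta> x (greedy_path (leftmost_step A \<beta> x) n)"
  proof (rule greedy_path_invariant)
    show "extendible A \<beta> x (s @ [leftmost_step A \<beta> x s])" if "extendible A \<beta> x s" for s
      using extendible_step[OF that] unfolding leftmost_step_def by (auto intro: LeastI)
  qed fact
  then have "x \<in> A (greedy_path (leftmost_step A \<beta> x) n)"
    unfolding extendible_def by (metis append_Nil2 length_0_conv le_refl add_0_right take_all_iff)
  then show ?thesis
    unfolding leftmost_branch_def by (subst (asm) greedy_path_eq_map)
qed

section \<open>Measurability of the leftmost branch and approximation of outer measure\<close>

abbreviation baire :: "(nat \<Rightarrow> nat) measure" where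
  "baire \<equiv> Pi\<^sub>M UNIV (\<lambda>_. count_space UNIV)"

context
  fixes X :: "'x measure" and A :: "nat list \<Rightarrow> 'x set"
  assumes A [measurable]: "\<And>s. A s \<in> sets X"
begin

text \<open>Here compactness pays off: an infinite branch would be a quantifier over an uncountable
  set, whereas \<open>extendible\<close> only quantifies over numbers and finite lists.\<close>

lemma extendible_measurable [measurable]: "Measurable.pred X (\<lambda>x. extendible A \<beta> x s)"
  unfolding extendible_def by measurable

lemma leftmost_branch_measurable: "leftmost_branch A \<beta> \<in> X \<rightarrow>\<^sub>M baire"
proof (rule measurable_PiM_single')
  have step [measurable]: "(\<lambda>x. leftmost_step A \<beta> x s) \<in> X \<rightarrow>\<^sub>M count_space UNIV" for s
    unfolding leftmost_step_def by measurable
  have path [measurable]: "(\<lambda>x. greedy_path (leftmost_step A \<beta> x) n) \<in> X \<rightarrow>\<^sub>M count_space UNIV" for n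
  proof (induction n)
    case (Suc n)
    \<comment> \<open>The new entry depends on \<open>x\<close> both directly and through the path.
      As the path takes countably many values, measurability can be checked for each fixed value
      \<open>s\<close>.\<close>
    have "(\<lambda>x. (\<lambda>s x. s @ [leftmost_step A \<beta> x s]) (greedy_path (leftmost_step A \<beta> x) n) x)
        \<in> X \<rightarrow>\<^sub>M count_space UNIV"
    proof (rule measurable_compose_countable[OF _ Suc])
      show "(\<lambda>x. s @ [leftmost_step A \<beta> x s]) \<in> X \<rightarrow>\<^sub>M count_space UNIV" for s
        by (rule measurable_compose[OF step]) simp
    qed
    then show ?case by simp
  qed simp
  show "(\<lambda>x. leftmost_branch A \<beta> x i) \<in> X \<rightarrow>\<^sub>M count_space UNIV" for i
    unfolding leftmost_branch_def
    by (rule measurable_compose_countable[OF step path])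
qed simp

text \<open>Bounds on the coordinates of the branches are fixed one after the other while the outer
  measure stays above \<open>c\<close>. The points that admit a bounded branch up to height
  \<open>n\<close> form decreasing measurable sets of measure at least \<open>c\<close>, and
  finiteness of the measure carries this over to their intersection.\<close>

lemma extendible_approx_suslin:
  assumes "finite_measure X" and c: "c < outer_measure_of X (suslin A)"
  shows "\<exists>\<beta>. c \<le> emeasure X {x \<in> space X. extendible A \<beta> x []}"
proof -
  interpret finite_measure X by fact
  \<comment> \<open>The points with a full branch whose first \<open>length b\<close> entries are
    bounded by \<open>b\<close>. Such sets need not be measurable, hence the outer measure.\<close>
  define E where "E b = {x. \<exists>z. (\<forall>i<length b. z i \<le> b ! i) \<and> (\<forall>n. x \<in> A (map z [0..<n]))}" for b
  have sub: "E b \<subseteq> space X" for b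
    using sets.sets_into_space[OF A] unfolding E_def by blast
  have "\<exists>k. c < outer_measure_of X (E (b @ [k]))" if "c < outer_measure_of X (E b)" for b
  proof -
    have "E b = (\<Union>k. E (b @ [k]))"
    proof (intro equalityI subsetI)
      fix x assume "x \<in> E b"
      then obtain z where z: "\<forall>i<length b. z i \<le> b ! i" "\<forall>n. x \<in> A (map z [0..<n])"
        unfolding E_def by blast
      then have "\<forall>i<length (b @ [z (length b)]). z i \<le> (b @ [z (length b)]) ! i"
        by (auto simp: nth_append less_Suc_eq)
      with z show "x \<in> (\<Union>k. E (b @ [k]))"
        unfolding E_def by blast
    next
      fix x assume "x \<in> (\<Union>k. E (b @ [k]))"
      then obtain z k where "\<forall>i<length (b @ [k]). z i \<le> (b @ [k]) ! i" "\<forall>n. x \<in> A (map z [0..<n])"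
        unfolding E_def by blast
      moreover from this(1) have "\<forall>i<length b. z i \<le> b ! i"
        by (simp add: nth_append) (metis less_SucI)
      ultimately show "x \<in> E b"
        unfolding E_def by blast
    qed
    moreover have "incseq (\<lambda>k. E (b @ [k]))"
    proof (rule incseq_SucI, rule)
      fix k x assume "x \<in> E (b @ [k])"
      then obtain z where "\<forall>i<length (b @ [k]). z i \<le> (b @ [k]) ! i" "\<forall>n. x \<in> A (map z [0..<n])"
        unfolding E_def by blast
      moreover from this(1) have "\<forall>i<length (b @ [Suc k]). z i \<le> (b @ [Suc k]) ! i"
        by (auto simp: nth_append less_Suc_eq)
      ultimately show "x \<in> E (b @ [Suc k])"
        unfolding E_def by blast
    qed
    \<comment> \<open>Continuity from below holds for the outer measure of arbitrary increasing
      sets, so some bound \<open>k\<close> on the next entry keeps the outer measure above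
      \<open>c\<close>.\<close>
    ultimately have "outer_measure_of X (E b) = (SUP k. outer_measure_of X (E (b @ [k])))"
      using SUP_outer_measure_of_incseq[of "\<lambda>k. E (b @ [k])" X] sub by simp
    then have "c < (SUP k. outer_measure_of X (E (b @ [k])))"
      using that by (rule subst)
    then show ?thesis
      unfolding less_SUP_iff by blast
  qed
  then have "\<forall>b. \<exists>k. c < outer_measure_of X (E b) \<longrightarrow> c < outer_measure_of X (E (b @ [k]))"
    by blast
  then obtain f where f: "\<And>b. c < outer_measure_of X (E b) \<Longrightarrow> c < outer_measure_of X (E (b @ [f b]))"
    by metis
  define \<beta> where "\<beta> i = f (greedy_path f i)" for i
  have "c < outer_measure_of X (E (greedy_path f n))" for n
    by (rule greedy_path_invariant) (use f c in \<open>auto simp: E_def suslin_def\<close>)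
  then have E: "c < outer_measure_of X (E (map \<beta> [0..<n]))" for n
    unfolding \<beta>_def by (subst (asm) greedy_path_eq_map)
  \<comment> \<open>A measurable superset of \<open>E (map \<beta> [0..<n])\<close>: only a finite
    branch of length \<open>n\<close> is demanded instead of an infinite one.\<close>
  define K where "K n = {x\<in>space X. \<exists>t. length t = n \<and> (\<forall>i<n. t ! i \<le> \<beta> i) \<and> (\<forall>k\<le>n. x \<in> A (take k t))}" for n
  have [measurable]: "K n \<in> sets X" for n
    unfolding K_def by measurable
  have K: "c \<le> emeasure X (K n)" for n
  proof -
    have "E (map \<beta> [0..<n]) \<subseteq> K n"
    proof
      fix x assume x: "x \<in> E (map \<beta> [0..<n])"
      then obtain z where z: "\<And>i. i < n \<Longrightarrow> z i \<le> \<beta> i" "\<And>k. x \<in> A (map z [0..<k])"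
        unfolding E_def by auto
      then show "x \<in> K n"
        using x sub unfolding K_def
        by (auto intro!: exI[of _ "map z [0..<n]"] simp: take_map)
    qed
    then have "outer_measure_of X (E (map \<beta> [0..<n])) \<le> emeasure X (K n)"
      by (metis outer_measure_of_mono outer_measure_of_eq \<open>K n \<in> sets X\<close>)
    with E[of n] show ?thesis by order
  qed
  have "decseq K"
  proof (rule decseq_SucI, rule)
    fix n x assume "x \<in> K (Suc n)"
    then obtain t where "x \<in> space X" "length t = Suc n" "\<forall>i<Suc n. t ! i \<le> \<beta> i" "\<forall>k\<le>Suc n. x \<in> A (take k t)"
      unfolding K_def by auto
    then show "x \<in> K n"
      unfolding K_def by (auto intro!: exI[of _ "take n t"] simp: min_def)
  qed
  then have "(INF n. emeasure X (K n)) = emeasure X (\<Inter>n. K n)"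
    by (intro INF_emeasure_decseq) auto
  moreover have "(\<Inter>n. K n) = {x \<in> space X. extendible A \<beta> x []}"
    unfolding K_def extendible_def by auto
  ultimately have "(INF n. emeasure X (K n)) = emeasure X {x \<in> space X. extendible A \<beta> x []}"
    by simp
  moreover have "c \<le> (INF n. emeasure X (K n))"
    using K by (intro INF_greatest)
  ultimately show ?thesis
    by auto
qed

text \<open>Countably many bounds \<beta> exhaust the outer measure of \<open>suslin A\<close>. On
  the measurable set that each of them defines, the leftmost branch is a measurable
  selector.\<close>

theorem suslin_selection:
  assumes "finite_measure X"
  obtains C N z where "C \<in> sets X" "N \<in> null_sets X" "suslin A \<subseteq> C \<union> N" "z \<in> X \<rightarrow>\<^sub>M baire"
    "\<And>x n. x \<in> C \<Longrightarrow> x \<in> A (map (z x) [0..<n])"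
proof -
  interpret finite_measure X by fact
  define K where "K \<beta> = {x \<in> space X. extendible A \<beta> x []}" for \<beta>
  have K [measurable]: "K \<beta> \<in> sets X" for \<beta>
    unfolding K_def by measurable
  have sub: "suslin A \<subseteq> space X"
    using sets.sets_into_space[OF A] unfolding suslin_def by blast
  have "outer_measure_of X (suslin A) \<le> (SUP \<beta>. emeasure X (K \<beta>))"
  proof (rule dense_le)
    fix c assume "c < outer_measure_of X (suslin A)"
    then obtain \<beta> where "c \<le> emeasure X (K \<beta>)"
      using extendible_approx_suslin[OF assms] unfolding K_def by blast
    then show "c \<le> (SUP \<beta>. emeasure X (K \<beta>))"
      by (intro SUP_upper2[of \<beta>]) auto
  qed
  \<comment> \<open>The supremum over all \<beta> is attained along a sequence, so a countable union
    of sets \<open>K \<beta>\<close> suffices.\<close>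
  moreover obtain g where g: "range g \<subseteq> range (\<lambda>\<beta>. emeasure X (K \<beta>))" "(SUP \<beta>. emeasure X (K \<beta>)) = (SUP i::nat. g i)"
    using ennreal_Sup_countable_SUP[of "range (\<lambda>\<beta>. emeasure X (K \<beta>))"] by auto
  have "\<forall>i. \<exists>\<beta>. g i = emeasure X (K \<beta>)"
    using g(1) by (blast dest: range_subsetD)
  then obtain \<beta> where \<beta>: "\<And>i. g i = emeasure X (K (\<beta> i))"
    by metis
  define C where "C = (\<Union>i. K (\<beta> i))"
  have C [measurable]: "C \<in> sets X"
    unfolding C_def by measurable
  have "(SUP i. g i) \<le> emeasure X C"
    unfolding \<beta> C_def by (intro SUP_least emeasure_mono) auto
  ultimately have le: "outer_measure_of X (suslin A) \<le> emeasure X C"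
    unfolding g(2) by (rule order_trans)
  \<comment> \<open>\<open>B\<close> is a measurable hull of \<open>suslin A\<close>. Since
    \<open>C\<close> lies inside \<open>suslin A\<close> and its measure is at least that of
    \<open>B\<close>, the set \<open>B - C\<close> is the exceptional null set.\<close>
  obtain B where B: "B \<in> sets X" "suslin A \<subseteq> B" "emeasure X B = outer_measure_of X (suslin A)"
    using outer_measure_of_attain[OF sub] by auto
  have "C \<subseteq> suslin A"
    unfolding C_def K_def suslin_def using leftmost_branch_mem by fast
  then have "emeasure X (B - C) = emeasure X B - emeasure X C"
    using B by (intro emeasure_Diff) auto
  also have "\<dots> = 0"
    using le unfolding B(3)[symmetric] by (intro diff_eq_0_ennreal) (auto simp: less_top[symmetric])
  finally have "B - C \<in> null_sets X"
    using B by (intro null_setsI) auto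
  \<comment> \<open>The least index of a set \<open>K (\<beta> i)\<close> containing
    \<open>x\<close> selects the bound measurably.\<close>
  moreover define i where "i x = (LEAST i. x \<in> K (\<beta> i))" for x
  have [measurable]: "i \<in> X \<rightarrow>\<^sub>M count_space UNIV"
    unfolding i_def by measurable
  have "(\<lambda>x. leftmost_branch A (\<beta> (i x)) x) \<in> X \<rightarrow>\<^sub>M baire"
    by (rule measurable_compose_countable[OF leftmost_branch_measurable]) measurable
  moreover have "x \<in> A (map (leftmost_branch A (\<beta> (i x)) x) [0..<n])" if "x \<in> C" for x n
  proof (rule leftmost_branch_mem)
    have "x \<in> K (\<beta> (i x))"
      using that unfolding C_def i_def by (auto intro: LeastI)
    then show "extendible A (\<beta> (i x)) x []"
      unfolding K_def by auto
  qed
  ultimately show ?thesis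
    using that[of C "B - C"] B C by blast
qed

end

section \<open>Uniformisation of measurable sets\<close>

text \<open>The conditions \<open>finitary\<close> are the clopen sets of \<open>(\<nat> \<rightarrow> \<nat>)\<^sup>2\<close> with measurable parameter \<open>x\<close>, uniformly so
  in \<open>x\<close>; then \<open>analytic_rel\<close> consists of projections of closed sets along the last factor.\<close>

definition finitary ::
    "'x measure \<Rightarrow> ('x \<Rightarrow> (nat \<Rightarrow> nat) \<Rightarrow> (nat \<Rightarrow> nat) \<Rightarrow> bool) \<Rightarrow> bool" where
  "finitary X P \<longleftrightarrow>
     (\<exists>m. \<forall>x y y' z z'. (\<forall>i<m. y i = y' i \<and> z i = z' i) \<longrightarrow> P x y z = P x y' z') \<and>
     (\<forall>y z. {x \<in> space X. P x y z} \<in> sets X)"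

definition analytic_rel :: "'x measure \<Rightarrow> ('x \<times> (nat \<Rightarrow> nat)) set \<Rightarrow> bool" where
  "analytic_rel X S \<longleftrightarrow>
     (\<exists>P. (\<forall>n::nat. finitary X (P n)) \<and>
        (\<forall>x\<in>space X. \<forall>y. (x, y) \<in> S \<longleftrightarrow> (\<exists>z. \<forall>n. P n x y z)))"

section \<open>Closure properties of analytic relations\<close>

lemma finitary_reindex:
  assumes "finitary X P"
  shows "finitary X (\<lambda>x y z. P x y (\<lambda>k. z (f k)))"
proof -
  obtain m where m: "\<And>x y y' z z'. (\<forall>i<m. y i = y' i \<and> z i = z' i) \<Longrightarrow> P x y z = P x y' z'"
    using assms unfolding finitary_def by blast
  obtain l where l: "\<And>k. k < m \<Longrightarrow> f k < l"
    using finite_nat_set_iff_bounded[of "f ` {..<m}"] by auto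
  \<comment> \<open>The reindexed \<open>z\<close> is consulted below \<open>l\<close>, but
    \<open>y\<close> is still consulted below \<open>m\<close>, hence the maximum.\<close>
  have "\<forall>x y y' z z'. (\<forall>i<max l m. y i = y' i \<and> z i = z' i) \<longrightarrow>
      P x y (\<lambda>k. z (f k)) = P x y' (\<lambda>k. z' (f k))"
    using l by (intro allI impI m) (simp add: less_max_iff_disj)
  with assms show ?thesis
    unfolding finitary_def by blast
qed

lemma finitary_guard:
  assumes "finitary X P"
  shows "finitary X (\<lambda>x y z. z 0 = i \<longrightarrow> P x y z)"
proof -
  obtain m where m: "\<And>x y y' z z'. (\<forall>i<m. y i = y' i \<and> z i = z' i) \<Longrightarrow> P x y z = P x y' z'"
    using assms unfolding finitary_def by blast
  have "(z 0 = i \<longrightarrow> P x y z) = (z' 0 = i \<longrightarrow> P x y' z')"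
    if "\<forall>i<Suc m. y i = y' i \<and> z i = z' i" for x y y' z z'
    using that m[of y y' z z' x] by auto
  moreover have "{x \<in> space X. z 0 = i \<longrightarrow> P x y z} \<in> sets X" for y z
    using assms unfolding finitary_def by (cases "z 0 = i") auto
  ultimately show ?thesis
    unfolding finitary_def by blast
qed

lemma analytic_rel_finitary:
  assumes "finitary X (\<lambda>x y z. (x, y) \<in> S)"
  shows "analytic_rel X S"
  unfolding analytic_rel_def using assms by (intro exI[of _ "\<lambda>n x y z. (x, y) \<in> S"]) auto

text \<open>A witness for the union is an index \<open>i\<close> followed by a witness for
  \<open>S i\<close>. All conditions are imposed at once, each guarded so that it only applies when
  \<open>z 0\<close> names its own member.\<close>

lemma analytic_rel_UN:
  fixes S :: "nat \<Rightarrow> ('x \<times> (nat \<Rightarrow> nat)) set"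
  assumes "\<And>i. analytic_rel X (S i)"
  shows "analytic_rel X (\<Union>i. S i)"
proof -
  have "\<forall>i. \<exists>P. (\<forall>n::nat. finitary X (P n)) \<and>
      (\<forall>x\<in>space X. \<forall>y. (x, y) \<in> S i \<longleftrightarrow> (\<exists>z. \<forall>n. P n x y z))"
    using assms unfolding analytic_rel_def by blast
  from choice[OF this] obtain P where P: "\<And>i n::nat. finitary X (P i n)"
      "\<And>i x y. x \<in> space X \<Longrightarrow> (x, y) \<in> S i \<longleftrightarrow> (\<exists>z. \<forall>n. P i n x y z)"
    by blast
  define Q where "Q n x y z \<longleftrightarrow>
      (z 0 = fst (prod_decode n) \<longrightarrow> P (fst (prod_decode n)) (snd (prod_decode n)) x y (\<lambda>k. z (Suc k)))"
    for n x y z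
  have "finitary X (Q n)" for n
    unfolding Q_def by (rule finitary_guard[OF finitary_reindex[OF P(1)]])
  moreover have "(x, y) \<in> (\<Union>i. S i) \<longleftrightarrow> (\<exists>z. \<forall>n. Q n x y z)" if x: "x \<in> space X" for x y
  proof
    assume "(x, y) \<in> (\<Union>i. S i)"
    then obtain i z where "\<And>n. P i n x y z"
      using P(2)[OF x] by blast
    then have "\<forall>n. Q n x y (case_nat i z)"
      unfolding Q_def by auto
    then show "\<exists>z. \<forall>n. Q n x y z" by blast
  next
    assume "\<exists>z. \<forall>n. Q n x y z"
    then obtain z where "\<And>n. Q n x y z" by blast
    from this[of "prod_encode (z 0, _)"] have "\<forall>n. P (z 0) n x y (\<lambda>k. z (Suc k))"
      unfolding Q_def by simp
    then show "(x, y) \<in> (\<Union>i. S i)"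
      using P(2)[OF x, of y "z 0"] by blast
  qed
  ultimately show ?thesis
    unfolding analytic_rel_def by (intro exI[of _ Q]) blast
qed

text \<open>Witnesses for all the \<open>S i\<close> are interleaved into one sequence by the
  pairing function.\<close>

lemma analytic_rel_INT:
  fixes S :: "nat \<Rightarrow> ('x \<times> (nat \<Rightarrow> nat)) set"
  assumes "\<And>i. analytic_rel X (S i)"
  shows "analytic_rel X (\<Inter>i. S i)"
proof -
  have "\<forall>i. \<exists>P. (\<forall>n::nat. finitary X (P n)) \<and>
      (\<forall>x\<in>space X. \<forall>y. (x, y) \<in> S i \<longleftrightarrow> (\<exists>z. \<forall>n. P n x y z))"
    using assms unfolding analytic_rel_def by blast
  from choice[OF this] obtain P where P: "\<And>i n::nat. finitary X (P i n)"
      "\<And>i x y. x \<in> space X \<Longrightarrow> (x, y) \<in> S i \<longleftrightarrow> (\<exists>z. \<forall>n. P i n x y z)"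
    by blast
  define Q where "Q n x y z \<longleftrightarrow>
      P (fst (prod_decode n)) (snd (prod_decode n)) x y (\<lambda>k. z (prod_encode (fst (prod_decode n), k)))"
    for n x y z
  have "finitary X (Q n)" for n
    unfolding Q_def by (rule finitary_reindex[OF P(1)])
  moreover have "(x, y) \<in> (\<Inter>i. S i) \<longleftrightarrow> (\<exists>z. \<forall>n. Q n x y z)" if x: "x \<in> space X" for x y
  proof
    assume "(x, y) \<in> (\<Inter>i. S i)"
    then have "\<forall>i. \<exists>z. \<forall>n. P i n x y z"
      using P(2)[OF x] by blast
    then obtain z where "\<And>i n. P i n x y (z i)"
      by metis
    then have "\<forall>n. Q n x y (\<lambda>k. z (fst (prod_decode k)) (snd (prod_decode k)))"
      unfolding Q_def by simp
    then show "\<exists>z. \<forall>n. Q n x y z" by blast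
  next
    assume "\<exists>z. \<forall>n. Q n x y z"
    then obtain z where z: "\<And>n. Q n x y z" by blast
    have "(x, y) \<in> S i" for i
    proof -
      have "\<forall>n. P i n x y (\<lambda>k. z (prod_encode (i, k)))"
        using z[of "prod_encode (i, _)"] unfolding Q_def by simp
      then show ?thesis
        using P(2)[OF x, of y i] by blast
    qed
    then show "(x, y) \<in> (\<Inter>i. S i)" by blast
  qed
  ultimately show ?thesis
    unfolding analytic_rel_def by (intro exI[of _ Q]) blast
qed

lemma analytic_rel_cong:
  assumes "S \<inter> space X \<times> UNIV = S' \<inter> space X \<times> UNIV"
  shows "analytic_rel X S \<longleftrightarrow> analytic_rel X S'"
proof -
  have "(x, y) \<in> S \<longleftrightarrow> (x, y) \<in> S'" if "x \<in> space X" for x y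
    using assms that by blast
  then show ?thesis
    unfolding analytic_rel_def by simp
qed

text \<open>Good sets principle, with both projections measurable for the \<sigma>-algebra of good
  sets.\<close>

lemma analytic_rel_sets:
  assumes S: "S \<in> sets (X \<Otimes>\<^sub>M baire)"
  shows "analytic_rel X S"
proof -
  define \<Omega> where "\<Omega> = space X \<times> (UNIV :: (nat \<Rightarrow> nat) set)"
  \<comment> \<open>Analytic relations are not closed under complements in general, so the
    complement is carried along. Finitary conditions qualify because their negations are again
    finitary.\<close>
  define F where "F = {S. S \<subseteq> \<Omega> \<and> analytic_rel X S \<and> analytic_rel X (\<Omega> - S)}"
  have finF: "S \<inter> \<Omega> \<in> F" if "finitary X (\<lambda>x y z. (x, y) \<in> S)" for S
  proof -
    have "{x \<in> space X. (x, y) \<notin> S} \<in> sets X" for y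
    proof -
      have "{x \<in> space X. (x, y) \<notin> S} = space X - {x \<in> space X. (x, y) \<in> S}" by auto
      then show ?thesis
        using that unfolding finitary_def by auto
    qed
    with that have "finitary X (\<lambda>x y z. (x, y) \<in> - S)"
      unfolding finitary_def by simp
    with that have "analytic_rel X S" "analytic_rel X (- S)"
      by (auto intro: analytic_rel_finitary)
    moreover have "analytic_rel X (S \<inter> \<Omega>) = analytic_rel X S"
        "analytic_rel X (\<Omega> - (S \<inter> \<Omega>)) = analytic_rel X (- S)"
      unfolding \<Omega>_def by (auto intro!: analytic_rel_cong)
    ultimately show ?thesis
      unfolding F_def by simp
  qed
  have F: "sigma_algebra \<Omega> F"
    unfolding sigma_algebra_iff2
  proof (intro conjI ballI allI impI)
    show "F \<subseteq> Pow \<Omega>"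
      unfolding F_def by auto
    have "finitary X (\<lambda>x y z. (x, y) \<in> {})"
      unfolding finitary_def by simp
    from finF[OF this] show "{} \<in> F" by simp
    show "\<Omega> - s \<in> F" if "s \<in> F" for s
      using that unfolding F_def by (auto simp: double_diff)
    show "(\<Union>i. A i) \<in> F" if "range A \<subseteq> F" for A :: "nat \<Rightarrow> _"
    proof -
      have A: "A i \<subseteq> \<Omega>" "analytic_rel X (A i)" "analytic_rel X (\<Omega> - A i)" for i
        using that unfolding F_def by auto
      have "\<Omega> - (\<Union>i. A i) = (\<Inter>i. \<Omega> - A i)" by auto
      then have "analytic_rel X (\<Omega> - (\<Union>i. A i))"
        using analytic_rel_INT[OF A(3)] by simp
      then show ?thesis
        unfolding F_def using analytic_rel_UN[of X A] A(1,2) by blast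
    qed
  qed
  define N where "N = sigma \<Omega> F"
  have "F \<subseteq> Pow \<Omega>"
    unfolding F_def by auto
  then have N [simp]: "space N = \<Omega>" "sets N = F"
    unfolding N_def using sigma_algebra.sigma_sets_eq[OF F] by (simp_all add: space_measure_of_conv)
  have "fst \<in> N \<rightarrow>\<^sub>M X"
  proof (rule measurableI)
    fix A assume A: "A \<in> sets X"
    then have "finitary X (\<lambda>x (y :: nat \<Rightarrow> nat) z. (x, y) \<in> A \<times> UNIV)"
      unfolding finitary_def by (auto simp: sets.Int_space_eq1 Int_def[symmetric] conj_commute
          intro!: sets.sets_Collect)
    from finF[OF this] show "fst -` A \<inter> space N \<in> sets N"
      by (simp add: vimage_fst)
  qed (auto simp: \<Omega>_def)
  moreover have "snd \<in> N \<rightarrow>\<^sub>M baire"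
  proof (rule measurable_PiM_single')
    fix i
    show "(\<lambda>p. snd p i) \<in> N \<rightarrow>\<^sub>M count_space UNIV"
      unfolding measurable_count_space_eq2_countable
    proof safe
      fix k
      have "finitary X (\<lambda>x y z. (x, y) \<in> UNIV \<times> {y. y i = k})"
        unfolding finitary_def by (auto intro!: exI[of _ "Suc i"])
      moreover have "(\<lambda>p. snd p i) -` {k} \<inter> \<Omega> = UNIV \<times> {y. y i = k} \<inter> \<Omega>"
        by auto
      ultimately show "(\<lambda>p. snd p i) -` {k} \<inter> space N \<in> sets N"
        using finF by simp
    qed auto
  qed simp
  \<comment> \<open>Measurability of the identity from \<open>N\<close> to the product says that
    every measurable set of the product, cut down to \<Omega>, is good.\<close>
  ultimately have "(\<lambda>p. (fst p, snd p)) \<in> N \<rightarrow>\<^sub>M X \<Otimes>\<^sub>M baire"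
    by (rule measurable_Pair)
  from measurable_sets[OF this S] have "S \<inter> \<Omega> \<in> F"
    by simp
  moreover have "S \<subseteq> \<Omega>"
    using sets.sets_into_space[OF S] by (auto simp: space_pair_measure \<Omega>_def)
  ultimately show ?thesis
    unfolding F_def by (simp add: Int_absorb2)
qed

section \<open>From Suslin schemes to measurable uniformisation\<close>

lemma measurable_selection_finite:
  assumes "finite_measure X" and S: "S \<in> sets (X \<Otimes>\<^sub>M baire)"
  obtains C N y where "C \<in> sets X" "N \<in> null_sets X" "fst ` S \<subseteq> C \<union> N" "y \<in> X \<rightarrow>\<^sub>M baire"
    "\<And>x. x \<in> C \<Longrightarrow> (x, y x) \<in> S"
proof -
  obtain P where P: "\<And>n::nat. finitary X (P n)"
      "\<And>x y. x \<in> space X \<Longrightarrow> (x, y) \<in> S \<longleftrightarrow> (\<exists>z. \<forall>n. P n x y z)"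
    using analytic_rel_sets[OF S] unfolding analytic_rel_def by blast
  \<comment> \<open>The point \<open>y\<close> and its witness \<open>z\<close> are coded by a
    single sequence \<open>w\<close>, so that projecting to \<open>X\<close> amounts to finding one
    branch \<open>w\<close>.\<close>
  define Q where "Q n x w = P n x (\<lambda>i. fst (prod_decode (w i))) (\<lambda>i. snd (prod_decode (w i)))" for n x w
  have [measurable]: "Measurable.pred X (\<lambda>x. Q n x w)" for n w
    using P(1) unfolding Q_def finitary_def pred_def by blast
  have "\<exists>m. \<forall>x w w'. (\<forall>i<m. w i = w' i) \<longrightarrow> Q n x w = Q n x w'" for n
  proof -
    obtain m where "\<forall>x y y' z z'. (\<forall>i<m. y i = y' i \<and> z i = z' i) \<longrightarrow> P n x y z = P n x y' z'"
      using P(1)[of n] unfolding finitary_def by blast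
    then show ?thesis
      unfolding Q_def by (intro exI[of _ m]) simp
  qed
  then obtain m where m: "\<And>n x w w'. (\<forall>i<m n. w i = w' i) \<Longrightarrow> Q n x w = Q n x w'"
    by metis
  \<comment> \<open>Only conditions with \<open>m n \<le> length s\<close> are imposed; they are
    decided by the entries of \<open>s\<close>, so the padding by 0 is arbitrary.\<close>
  define A where "A s = {x \<in> space X. \<forall>n. m n \<le> length s \<longrightarrow> Q n x (\<lambda>i. if i < length s then s ! i else 0)}" for s
  have A [measurable]: "A s \<in> sets X" for s
    unfolding A_def by measurable
  have A_iff: "(\<forall>k. x \<in> A (map w [0..<k])) \<longleftrightarrow> x \<in> space X \<and> (\<forall>n. Q n x w)" for x w
  proof -
    have "Q n x (\<lambda>i. if i < k then map w [0..<k] ! i else 0) = Q n x w" if "m n \<le> k" for n k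
      using that by (intro m) auto
    then show ?thesis
      unfolding A_def by auto
  qed
  obtain C N w where *: "C \<in> sets X" "N \<in> null_sets X" "suslin A \<subseteq> C \<union> N" "w \<in> X \<rightarrow>\<^sub>M baire"
      "\<And>x n. x \<in> C \<Longrightarrow> x \<in> A (map (w x) [0..<n])"
    by (rule suslin_selection[where X = X and A = A, OF A assms(1)]) (rule that)
  have w: "(\<lambda>x. w x i) \<in> X \<rightarrow>\<^sub>M count_space UNIV" for i
    by (rule measurable_compose[OF *(4) measurable_component_singleton]) simp
  show ?thesis
  proof (rule that[OF *(1,2)])
    show "fst ` S \<subseteq> C \<union> N"
    proof (intro subset_trans[OF _ *(3)] subsetI)
      fix x assume "x \<in> fst ` S"
      then obtain y where y: "(x, y) \<in> S" by force
      with sets.sets_into_space[OF S] have x: "x \<in> space X"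
        by (auto simp: space_pair_measure)
      with y obtain z where "\<And>n. P n x y z"
        using P(2) by blast
      then have "\<forall>n. Q n x (\<lambda>i. prod_encode (y i, z i))"
        unfolding Q_def by simp
      with x show "x \<in> suslin A"
        unfolding suslin_def A_iff by blast
    qed
    show "(\<lambda>x i. fst (prod_decode (w x i))) \<in> X \<rightarrow>\<^sub>M baire"
      by (rule measurable_PiM_single', rule measurable_compose[OF w]) auto
    fix x assume "x \<in> C"
    with *(5) have "x \<in> space X \<and> (\<forall>n. Q n x (w x))"
      unfolding A_iff[symmetric] by blast
    then show "(x, \<lambda>i. fst (prod_decode (w x i))) \<in> S"
      unfolding Q_def using P(2) by blast
  qed
qed

text \<open>A strictly positive integrable density \<open>h\<close> turns the measure into a finite
  one with the same measurable sets, and positivity ensures that its null sets are null for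
  \<open>X\<close>.\<close>

theorem measurable_selection:
  assumes "sigma_finite_measure X" and S: "S \<in> sets (X \<Otimes>\<^sub>M baire)"
  obtains C N y where "C \<in> sets X" "N \<in> null_sets X" "fst ` S \<subseteq> C \<union> N" "y \<in> X \<rightarrow>\<^sub>M baire"
    "\<And>x. x \<in> C \<Longrightarrow> (x, y x) \<in> S"
proof -
  interpret sigma_finite_measure X by fact
  obtain h where h [measurable]: "h \<in> borel_measurable X"
      and fin: "integral\<^sup>N X h \<noteq> \<infinity>" and pos: "\<And>x. x \<in> space X \<Longrightarrow> 0 < h x"
    using Ex_finite_integrable_function by blast
  define Y where "Y = density X h"
  have [measurable_cong]: "sets Y = sets X"
    unfolding Y_def by simp
  have "emeasure Y (space Y) \<noteq> \<infinity>"
    using fin by (simp add: Y_def emeasure_density cong: nn_integral_cong)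
  then have "finite_measure Y"
    by (rule finite_measureI)
  have "S \<in> sets (Y \<Otimes>\<^sub>M baire)"
    using S by (simp cong: sets_pair_measure_cong add: \<open>sets Y = sets X\<close>)
  have "null_sets Y \<subseteq> null_sets X"
  proof
    fix N assume "N \<in> null_sets Y"
    then have "N \<in> sets X" and AE: "AE x in X. x \<in> N \<longrightarrow> h x = 0"
      unfolding Y_def by (auto simp: null_sets_density_iff)
    from AE have "AE x in X. x \<notin> N"
      by (rule AE_mp) (use pos in \<open>intro AE_I2, force\<close>)
    with \<open>N \<in> sets X\<close> show "N \<in> null_sets X"
      by (simp add: AE_iff_null_sets)
  qed
  moreover obtain C N y where "C \<in> sets Y" "N \<in> null_sets Y" "fst ` S \<subseteq> C \<union> N" "y \<in> Y \<rightarrow>\<^sub>M baire"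
      "\<And>x. x \<in> C \<Longrightarrow> (x, y x) \<in> S"
    by (rule measurable_selection_finite[OF \<open>finite_measure Y\<close> \<open>S \<in> sets (Y \<Otimes>\<^sub>M baire)\<close>]) (rule that)
  ultimately show ?thesis
    using that[of C N y] by (auto simp: measurable_cong_sets[OF \<open>sets Y = sets X\<close> refl] \<open>sets Y = sets X\<close>)
qed

section \<open>Standard Borel spaces\<close>

lemma polish_topology_metric:
  assumes "polish_topology T" and "topspace T \<noteq> {}"
  obtains d and e :: "nat \<Rightarrow> 'a" where "Metric_space (topspace T) d"
    "Metric_space.mcomplete (topspace T) d" "Metric_space.mtopology (topspace T) d = T"
    "\<And>i. e i \<in> topspace T" "\<And>x r. x \<in> topspace T \<Longrightarrow> 0 < r \<Longrightarrow> \<exists>i. d (e i) x < r"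
proof -
  obtain M d where d: "Metric_space M d" "Metric_space.mcomplete M d" "T = Metric_space.mtopology M d"
    using assms(1) unfolding polish_topology_def completely_metrizable_space_def by blast
  interpret Metric_space M d by fact
  have M: "topspace T = M"
    using d(3) by simp
  obtain D where D: "countable D" "D \<subseteq> M" "T closure_of D = M"
    using assms(1) M unfolding polish_topology_def separable_space_def by auto
  with assms(2) M have "D \<noteq> {}" by auto
  have "\<exists>i. d (from_nat_into D i) x < r" if x: "x \<in> M" and "0 < r" for x r
  proof -
    from x D(3) have "x \<in> mtopology closure_of D"
      using d(3) by simp
    with \<open>0 < r\<close> obtain y where "y \<in> D" "d x y < r"
      unfolding metric_closure_of by (auto simp: in_mball)
    with D \<open>D \<noteq> {}\<close> show ?thesis
      by (metis commute from_nat_into_surj)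
  qed
  moreover have "from_nat_into D i \<in> M" for i
    using from_nat_into[OF \<open>D \<noteq> {}\<close>] D(2) by blast
  ultimately show ?thesis
    using that[of d "from_nat_into D"] d M by simp
qed

lemma space_borel_of [simp]: "space (borel_of T) = topspace T"
  unfolding borel_of_def by (rule space_measure_of_conv)

lemma borel_of_open: "openin T U \<Longrightarrow> U \<in> sets (borel_of T)"
  unfolding borel_of_def by (rule in_measure_of) (auto dest: openin_subset)

text \<open>Pull back the balls of radius \<open>1 / Suc n\<close> around a dense sequence in the
  Polish model. A ball of radius below half the distance of two points cannot contain both.\<close>

lemma standard_borel_separating:
  assumes "standard_borel M"
  obtains E :: "nat \<Rightarrow> 'a set" where "\<And>n. E n \<in> sets M"
    "\<And>x y. x \<in> space M \<Longrightarrow> y \<in> space M \<Longrightarrow> (\<And>n. x \<in> E n \<longleftrightarrow> y \<in> E n) \<Longrightarrow> x = y"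
proof (cases "space M = {}")
  case True
  then show ?thesis
    using that[of "\<lambda>_. {}"] by simp
next
  case False
  obtain P :: "real topology" and B where P: "polish_topology P" and B: "B \<in> sets (borel_of P)"
      and "measurable_isomorphic M (restrict_space (borel_of P) B)"
    using assms unfolding standard_borel_def by blast
  then obtain f g where f: "f \<in> M \<rightarrow>\<^sub>M restrict_space (borel_of P) B"
      and gf: "\<And>x. x \<in> space M \<Longrightarrow> g (f x) = x"
    unfolding measurable_isomorphic_def by blast
  from f have f': "f \<in> M \<rightarrow>\<^sub>M borel_of P"
    by (simp add: measurable_restrict_space2_iff)
  have fP: "f x \<in> topspace P" if "x \<in> space M" for x
    using measurable_space[OF f' that] by simp
  with False have "topspace P \<noteq> {}" by blast
  then obtain d and e :: "nat \<Rightarrow> real" where d: "Metric_space (topspace P) d"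
      "Metric_space.mtopology (topspace P) d = P"
      and e: "\<And>i. e i \<in> topspace P" "\<And>x r. x \<in> topspace P \<Longrightarrow> 0 < r \<Longrightarrow> \<exists>i. d (e i) x < r"
    using polish_topology_metric[OF P] by metis
  interpret Metric_space "topspace P" d by fact
  define E where "E k = f -` mball (e (fst (prod_decode k))) (1 / Suc (snd (prod_decode k))) \<inter> space M" for k
  show ?thesis
  proof (rule that)
    have "openin P (mball x r)" for x r
      using openin_mball[of x r] d(2) by simp
    then show "E k \<in> sets M" for k
      unfolding E_def by (intro measurable_sets[OF f'] borel_of_open)
    fix x y assume xy: "x \<in> space M" "y \<in> space M" and E: "\<And>n. x \<in> E n \<longleftrightarrow> y \<in> E n"
    have "f x = f y"
    proof (rule ccontr)
      assume "f x \<noteq> f y"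
      with xy have "0 < d (f x) (f y)"
        using fP mdist_pos_less by blast
      then obtain n where n: "1 / Suc n < d (f x) (f y) / 2"
        using nat_approx_posE[of "d (f x) (f y) / 2"] by auto
      obtain i where i: "d (e i) (f x) < 1 / Suc n"
        using e(2)[OF fP[OF xy(1)], of "1 / Suc n"] by auto
      then have "x \<in> E (prod_encode (i, n))"
        unfolding E_def using xy fP e by (simp add: in_mball)
      then have "y \<in> E (prod_encode (i, n))"
        using E by simp
      then have "d (e i) (f y) < 1 / Suc n"
        unfolding E_def by (simp add: in_mball)
      with i n show False
        using triangle[OF fP[OF xy(1)] e(1) fP[OF xy(2)], of i] commute[of "e i" "f x"] by simp
    qed
    then show "x = y"
      using gf xy by metis
  qed
qed

text \<open>A separating sequence turns equality of values into countably many measurable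
  conditions. This is used for the graph condition in \<open>borel_selection\<close>.\<close>

lemma standard_borel_equalizer:
  assumes "standard_borel X" and f [measurable]: "f \<in> M \<rightarrow>\<^sub>M X" and g [measurable]: "g \<in> M \<rightarrow>\<^sub>M X"
  shows "{x \<in> space M. f x = g x} \<in> sets M"
proof -
  obtain E :: "nat \<Rightarrow> _" where [measurable]: "\<And>n. E n \<in> sets X"
      and E: "\<And>x y. x \<in> space X \<Longrightarrow> y \<in> space X \<Longrightarrow> (\<And>n. x \<in> E n \<longleftrightarrow> y \<in> E n) \<Longrightarrow> x = y"
    using standard_borel_separating[OF assms(1)] by blast
  have "{x \<in> space M. f x = g x} = {x \<in> space M. \<forall>n. f x \<in> E n \<longleftrightarrow> g x \<in> E n}"
  proof (intro Collect_cong conj_cong refl)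
    fix x assume "x \<in> space M"
    then show "f x = g x \<longleftrightarrow> (\<forall>n. f x \<in> E n \<longleftrightarrow> g x \<in> E n)"
      using E[OF measurable_space[OF f] measurable_space[OF g], of x x] by auto
  qed
  also have "\<dots> \<in> sets M"
    by measurable
  finally show ?thesis .
qed

text \<open>The isomorphism restricts to \<open>A\<close> and its copy \<open>C\<close>, which is
  Borel in the Polish space because \<open>B\<close> is.\<close>

lemma standard_borel_restrict:
  assumes "standard_borel M" and A: "A \<inter> space M \<in> sets M"
  shows "standard_borel (restrict_space M A)"
proof -
  obtain P :: "real topology" and B where P: "polish_topology P" "B \<in> sets (borel_of P)"
      "measurable_isomorphic M (restrict_space (borel_of P) B)"
    using assms unfolding standard_borel_def by blast
  let ?N = "restrict_space (borel_of P) B"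
  obtain f g where f: "f \<in> M \<rightarrow>\<^sub>M ?N" and g: "g \<in> ?N \<rightarrow>\<^sub>M M"
      and gf: "\<And>x. x \<in> space M \<Longrightarrow> g (f x) = x" and fg: "\<And>y. y \<in> space ?N \<Longrightarrow> f (g y) = y"
    using P(3) unfolding measurable_isomorphic_def by blast
  have B: "B \<subseteq> topspace P"
    using sets.sets_into_space[OF P(2)] by simp
  define C where "C = g -` (A \<inter> space M) \<inter> space ?N"
  have "C \<in> sets ?N"
    unfolding C_def by (rule measurable_sets[OF g A])
  then have C: "C \<in> sets (borel_of P)" "C \<subseteq> B"
    using P(2) B by (auto simp: sets_restrict_space_iff Int_absorb2)
  have N: "space ?N = B" "space (restrict_space (borel_of P) C) = C"
    using B C by (auto simp: space_restrict_space)
  have "f \<in> restrict_space M A \<rightarrow>\<^sub>M restrict_space (borel_of P) C"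
  proof (rule measurable_restrict_space2)
    show "f \<in> space (restrict_space M A) \<rightarrow> C"
      using measurable_space[OF f] gf by (auto simp: C_def space_restrict_space)
    show "f \<in> restrict_space M A \<rightarrow>\<^sub>M borel_of P"
      using f by (intro measurable_restrict_space1) (simp add: measurable_restrict_space2_iff)
  qed
  moreover have "g \<in> restrict_space (borel_of P) C \<rightarrow>\<^sub>M restrict_space M A"
  proof (rule measurable_restrict_space2)
    show "g \<in> space (restrict_space (borel_of P) C) \<rightarrow> A"
      unfolding N by (auto simp: C_def)
    have "g \<in> restrict_space ?N C \<rightarrow>\<^sub>M M"
      by (rule measurable_restrict_space1[OF g])
    moreover have "restrict_space ?N C = restrict_space (borel_of P) C"
      using C P(2) B C(2)[THEN subset_trans, OF B]
      by (subst restrict_restrict_space) (auto simp: Int_absorb1 Int_absorb2)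
    ultimately show "g \<in> restrict_space (borel_of P) C \<rightarrow>\<^sub>M M"
      by simp
  qed
  moreover have "\<forall>x\<in>space (restrict_space M A). g (f x) = x"
    using gf by (auto simp: space_restrict_space)
  moreover have "\<forall>y\<in>space (restrict_space (borel_of P) C). f (g y) = y"
    using fg C(2) unfolding N by auto
  ultimately have "measurable_isomorphic (restrict_space M A) (restrict_space (borel_of P) C)"
    unfolding measurable_isomorphic_def by blast
  then show ?thesis
    using P(1) C(1) unfolding standard_borel_def by blast
qed

text \<open>A point is coded by the indices of a rapidly converging sequence in a countable dense set.\<close>

lemma polish_baire_param:
  assumes P: "polish_topology P"
  obtains D g where "D \<in> sets baire" "g \<in> restrict_space baire D \<rightarrow>\<^sub>M borel_of P" "topspace P \<subseteq> g ` D"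
proof (cases "topspace P = {}")
  case True
  then show ?thesis
    by (intro that[of "{}" undefined]) (auto simp: measurable_def space_restrict_space)
next
  case False
  obtain d and e :: "nat \<Rightarrow> 'a" where d: "Metric_space (topspace P) d"
      "Metric_space.mcomplete (topspace P) d" "Metric_space.mtopology (topspace P) d = P"
      and e: "\<And>i. e i \<in> topspace P" "\<And>x r. x \<in> topspace P \<Longrightarrow> 0 < r \<Longrightarrow> \<exists>i. d (e i) x < r"
    using polish_topology_metric[OF P False] by metis
  interpret Metric_space "topspace P" d by fact
  define D where "D = {y. \<forall>n m. n \<le> m \<longrightarrow> d (e (y n)) (e (y m)) < (1/2) ^ n}"
  \<comment> \<open>The factor 2 lets the limit of the coded sequence satisfy the strict inequality.
    As the radii tend to 0, at most one point does, so the choice is forced.\<close>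
  define g where "g y = (SOME p. p \<in> topspace P \<and> (\<forall>n. d (e (y n)) p < 2 * (1/2) ^ n))" for y
  have coord [measurable]: "(\<lambda>y. y i) \<in> baire \<rightarrow>\<^sub>M count_space UNIV" for i
    by (rule measurable_component_singleton) simp
  \<comment> \<open>Quantifying over the values \<open>i\<close> and \<open>j\<close> leaves
    conditions on single coordinates, which are measurable.\<close>
  have "D = {y \<in> space baire. \<forall>n m i j. n \<le> m \<longrightarrow> y n = i \<longrightarrow> y m = j \<longrightarrow> d (e i) (e j) < (1/2) ^ n}"
    unfolding D_def by (auto simp: space_PiM)
  also have "\<dots> \<in> sets baire"
    by measurable
  finally have D [measurable]: "D \<in> sets baire" .
  have g: "g y \<in> topspace P" "d (e (y n)) (g y) < 2 * (1/2) ^ n" if y: "y \<in> D" for y n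
  proof -
    have "MCauchy (\<lambda>n. e (y n))"
      unfolding MCauchy_def
    proof (intro conjI allI impI)
      show "range (\<lambda>n. e (y n)) \<subseteq> topspace P"
        using e(1) by auto
      fix \<epsilon> :: real assume "0 < \<epsilon>"
      then obtain N where N: "(1/2) ^ N < \<epsilon>"
        using real_arch_pow_inv[of \<epsilon> "1/2"] by auto
      have "d (e (y n)) (e (y m)) < \<epsilon>" if "N \<le> n" "n \<le> m" for n m
      proof -
        have "d (e (y n)) (e (y m)) < (1/2) ^ n"
          using y that unfolding D_def by blast
        also have "(1/2 :: real) ^ n \<le> (1/2) ^ N"
          using that by (intro power_decreasing) auto
        finally show ?thesis using N by simp
      qed
      then have "\<forall>n n'. N \<le> n \<longrightarrow> N \<le> n' \<longrightarrow> d (e (y n)) (e (y n')) < \<epsilon>"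
        by (metis commute linear)
      then show "\<exists>N. \<forall>n n'. N \<le> n \<longrightarrow> N \<le> n' \<longrightarrow> d (e (y n)) (e (y n')) < \<epsilon>"
        by blast
    qed
    then obtain p where p: "limitin mtopology (\<lambda>n. e (y n)) p sequentially"
      using d(2) unfolding mcomplete_def by blast
    then have pP: "p \<in> topspace P"
      by (simp add: limitin_metric)
    have lim: "d (e (y n)) p < 2 * (1/2) ^ n" for n
    proof -
      have "\<forall>\<^sub>F m in sequentially. e (y m) \<in> topspace P \<and> d (e (y m)) p < (1/2) ^ n"
        using p unfolding limitin_metric by simp
      then obtain N where "\<And>m. N \<le> m \<Longrightarrow> d (e (y m)) p < (1/2) ^ n"
        unfolding eventually_sequentially by blast
      then have "d (e (y (max N n))) p < (1/2) ^ n"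
        by simp
      moreover have "d (e (y n)) (e (y (max N n))) < (1/2) ^ n"
        using y unfolding D_def by simp
      ultimately show ?thesis
        using triangle[OF e(1) e(1) pP, of "y n" "y (max N n)"] by simp
    qed
    have "p \<in> topspace P \<and> (\<forall>n. d (e (y n)) p < 2 * (1/2) ^ n)"
      using pP lim by simp
    then have "g y \<in> topspace P \<and> (\<forall>n. d (e (y n)) (g y) < 2 * (1/2) ^ n)"
      unfolding g_def by (rule someI)
    then show "g y \<in> topspace P" "d (e (y n)) (g y) < 2 * (1/2) ^ n"
      by auto
  qed
  have small: "\<exists>n. c * (1/2) ^ n < r" if "0 < c" "0 < r" for c r :: real
    using real_arch_pow_inv[of "r / c" "1/2"] that by (auto simp: field_simps)
  have "g \<in> restrict_space baire D \<rightarrow>\<^sub>M borel_of P"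
    unfolding borel_of_def
  proof (rule measurable_measure_of)
    fix O' assume "O' \<in> {U. openin P U}"
    then have O: "openin mtopology O'"
      using d(3) by simp
    \<comment> \<open>Whether \<open>g y\<close> lies in an open set is decided by some finite
      stage: the ball of radius \<open>2 * (1/2) ^ n\<close> around \<open>e (y n)\<close> contains
      \<open>g y\<close> and, for large \<open>n\<close>, fits into the open set.\<close>
    have "g -` O' \<inter> space (restrict_space baire D) =
        {y \<in> space (restrict_space baire D). \<exists>n i. y n = i \<and> mball (e i) (2 * (1/2) ^ n) \<subseteq> O'}"
      (is "?L = ?R")
    proof (intro equalityI subsetI)
      fix y assume "y \<in> ?L"
      then have y: "y \<in> D" "g y \<in> O'"
        by (auto simp: space_restrict_space)
      then obtain r where r: "0 < r" "mball (g y) r \<subseteq> O'"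
        using O unfolding openin_mtopology by blast
      then obtain n where n: "4 * (1/2) ^ n < r"
        using small[of 4 r] by auto
      have "mball (e (y n)) (2 * (1/2) ^ n) \<subseteq> mball (g y) r"
      proof
        fix q assume "q \<in> mball (e (y n)) (2 * (1/2) ^ n)"
        then have q: "q \<in> topspace P" "d (e (y n)) q < 2 * (1/2) ^ n"
          by (auto simp: in_mball)
        have "d (g y) q < r"
          using n q(2) g(2)[OF y(1), of n] triangle[OF g(1)[OF y(1)] e(1) q(1), of "y n"]
            commute[of "g y" "e (y n)"] by linarith
        with g(1)[OF y(1)] q(1) show "q \<in> mball (g y) r"
          by (simp add: in_mball)
      qed
      with r(2) have "mball (e (y n)) (2 * (1/2) ^ n) \<subseteq> O'"
        by (rule subset_trans[rotated])
      with \<open>y \<in> ?L\<close> show "y \<in> ?R"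
        by blast
    next
      fix y assume "y \<in> ?R"
      then obtain n where y: "y \<in> D" "mball (e (y n)) (2 * (1/2) ^ n) \<subseteq> O'"
        by (auto simp: space_restrict_space)
      have "g y \<in> mball (e (y n)) (2 * (1/2) ^ n)"
        unfolding in_mball using e(1) g[OF y(1)] by blast
      with y(2) \<open>y \<in> ?R\<close> show "y \<in> ?L"
        by blast
    qed
    also have "\<dots> \<in> sets (restrict_space baire D)"
    proof -
      have [measurable]: "(\<lambda>y. y n) \<in> restrict_space baire D \<rightarrow>\<^sub>M count_space UNIV" for n
        by (rule measurable_restrict_space1[OF coord])
      show ?thesis by measurable
    qed
    finally show "g -` O' \<inter> space (restrict_space baire D) \<in> sets (restrict_space baire D)" .
  qed (use g in \<open>auto simp: space_restrict_space dest: openin_subset\<close>)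
  moreover have "topspace P \<subseteq> g ` D"
  proof
    fix p assume p: "p \<in> topspace P"
    \<comment> \<open>The bound is halved so that the distances of two such points to
      \<open>p\<close> add up to less than \<open>(1/2) ^ n\<close>, as \<open>D\<close>
      requires.\<close>
    have "\<forall>n. \<exists>i. d (e i) p < (1/2) ^ n / 2"
      by (intro allI e(2)[OF p]) simp
    then obtain y where y: "\<And>n. d (e (y n)) p < (1/2) ^ n / 2"
      by metis
    have yD: "y \<in> D"
      unfolding D_def
    proof (intro CollectI allI impI)
      fix n m :: nat assume "n \<le> m"
      then have "(1/2 :: real) ^ m \<le> (1/2) ^ n"
        by (intro power_decreasing) auto
      then show "d (e (y n)) (e (y m)) < (1/2) ^ n"
        using y[of n] y[of m] triangle[OF e(1) p e(1), of "y n" "y m"] commute[of p "e (y m)"] by linarith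
    qed
    have "g y = p"
    proof (rule ccontr)
      assume "g y \<noteq> p"
      then have "0 < d (g y) p"
        using g(1)[OF yD] p mdist_pos_less by blast
      then obtain n where "3 * (1/2) ^ n < d (g y) p"
        using small[of 3 "d (g y) p"] by auto
      moreover have "0 < (1/2 :: real) ^ n"
        by simp
      ultimately show False
        using y[of n] g(2)[OF yD, of n] triangle[OF g(1)[OF yD] e(1) p, of "y n"]
          commute[of "g y" "e (y n)"] by linarith
    qed
    with yD show "p \<in> g ` D" by blast
  qed
  ultimately show ?thesis
    using that[OF D] by blast
qed

lemma standard_borel_baire_param:
  assumes "standard_borel M"
  obtains D g where "D \<in> sets baire" "g \<in> restrict_space baire D \<rightarrow>\<^sub>M M" "space M \<subseteq> g ` D"
proof -
  obtain P :: "real topology" and B where P: "polish_topology P" "B \<in> sets (borel_of P)"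
      "measurable_isomorphic M (restrict_space (borel_of P) B)"
    using assms unfolding standard_borel_def by blast
  let ?N = "restrict_space (borel_of P) B"
  obtain f h where f: "f \<in> M \<rightarrow>\<^sub>M ?N" and h: "h \<in> ?N \<rightarrow>\<^sub>M M"
      and hf: "\<And>x. x \<in> space M \<Longrightarrow> h (f x) = x"
    using P(3) unfolding measurable_isomorphic_def by blast
  obtain D g where D: "D \<in> sets baire" and g: "g \<in> restrict_space baire D \<rightarrow>\<^sub>M borel_of P"
      and surj: "topspace P \<subseteq> g ` D"
    by (rule polish_baire_param[OF P(1)]) (rule that)
  define D' where "D' = g -` B \<inter> space (restrict_space baire D)"
  have D': "D' \<in> sets baire" "D' \<subseteq> D"
    using measurable_sets[OF g P(2)] D sets.sets_into_space[OF D]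
    unfolding D'_def by (auto simp: sets_restrict_space_iff space_restrict_space)
  have "g \<in> restrict_space (restrict_space baire D) D' \<rightarrow>\<^sub>M ?N"
    by (intro measurable_restrict_space2 measurable_restrict_space1 g)
      (auto simp: space_restrict_space D'_def)
  then have "g \<in> restrict_space baire D' \<rightarrow>\<^sub>M ?N"
    using D D' by (subst (asm) restrict_restrict_space) (auto simp: Int_absorb1)
  then have "(\<lambda>y. h (g y)) \<in> restrict_space baire D' \<rightarrow>\<^sub>M M"
    by (rule measurable_compose[OF _ h])
  moreover have "space M \<subseteq> (\<lambda>y. h (g y)) ` D'"
  proof
    fix x assume x: "x \<in> space M"
    then have fx: "f x \<in> B" "f x \<in> topspace P"
      using measurable_space[OF f] by (auto simp: space_restrict_space)
    with surj obtain y where "y \<in> D" "f x = g y" by blast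
    with fx x show "x \<in> (\<lambda>y. h (g y)) ` D'"
      using hf[OF x] by (intro image_eqI[of _ _ y]) (auto simp: D'_def space_restrict_space space_PiM)
  qed
  ultimately show ?thesis
    using that[OF D'(1)] by blast
qed

section \<open>Sections of Borel maps\<close>

text \<open>Composing a selector into the Baire space with the parametrisation \<open>g\<close> of
  \<open>V\<close> gives the section; the null set comes from
  \<open>measurable_selection\<close>.\<close>

lemma borel_selection:
  fixes X :: "'x measure" and V :: "('x \<times> 'v) measure"
  assumes X: "standard_borel X" "sigma_finite_measure X" and V: "standard_borel V"
    and fst: "fst \<in> V \<rightarrow>\<^sub>M X" and U: "U \<in> sets V"
  obtains C N s where "C \<in> sets X" "N \<in> null_sets X" "fst ` U \<subseteq> C \<union> N"
    "(\<lambda>x. (x, s x)) \<in> restrict_space X C \<rightarrow>\<^sub>M V" "\<And>x. x \<in> C \<Longrightarrow> (x, s x) \<in> U"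
proof -
  obtain D g where D: "D \<in> sets baire" and g: "g \<in> restrict_space baire D \<rightarrow>\<^sub>M V"
      and surj: "space V \<subseteq> g ` D"
    by (rule standard_borel_baire_param[OF V]) (rule that)
  define M where "M = restrict_space (X \<Otimes>\<^sub>M baire) (space X \<times> D)"
  have XD: "space X \<times> D \<in> sets (X \<Otimes>\<^sub>M baire)"
    using D by simp
  have spM: "space M = space X \<times> D"
    using sets.sets_into_space[OF XD] by (auto simp: M_def space_restrict_space)
  have "snd \<in> M \<rightarrow>\<^sub>M restrict_space baire D"
    unfolding M_def by (intro measurable_restrict_space2 measurable_restrict_space1)
      (auto simp: space_restrict_space)
  then have gM: "(\<lambda>p. g (snd p)) \<in> M \<rightarrow>\<^sub>M V"
    by (rule measurable_compose[OF _ g])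
  have fM: "fst \<in> M \<rightarrow>\<^sub>M X"
    unfolding M_def by (intro measurable_restrict_space1) simp
  \<comment> \<open>The codes \<open>y\<close> of points \<open>g y\<close> of \<open>U\<close>
    lying over \<open>x\<close>; the equation makes a selector of \<open>S\<close> a
    section.\<close>
  define S where "S = {p \<in> space M. fst (g (snd p)) = fst p} \<inter> ((\<lambda>p. g (snd p)) -` U \<inter> space M)"
  have "S \<in> sets M"
    unfolding S_def using standard_borel_equalizer[OF X(1) measurable_compose[OF gM fst] fM] measurable_sets[OF gM U]
    by auto
  then have S: "S \<in> sets (X \<Otimes>\<^sub>M baire)"
    using XD unfolding M_def by (subst (asm) sets_restrict_space_iff) auto
  obtain C N y where y: "C \<in> sets X" "N \<in> null_sets X" "fst ` S \<subseteq> C \<union> N" "y \<in> X \<rightarrow>\<^sub>M baire"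
      "\<And>x. x \<in> C \<Longrightarrow> (x, y x) \<in> S"
    by (rule measurable_selection[OF X(2) S]) (rule that)
  have C: "y x \<in> D" "fst (g (y x)) = x" "g (y x) \<in> U" if "x \<in> C" for x
    using y(5)[OF that] unfolding S_def spM by auto
  show ?thesis
  proof (rule that[OF y(1,2), of "\<lambda>x. snd (g (y x))"])
    show "fst ` U \<subseteq> C \<union> N"
    proof (intro subset_trans[OF _ y(3)] subsetI)
      fix x assume "x \<in> fst ` U"
      then obtain u where u: "u \<in> U" "x = fst u" by blast
      then have uV: "u \<in> space V"
        using sets.sets_into_space[OF U] by blast
      then obtain z where "z \<in> D" "g z = u"
        using surj by blast
      then have "(x, z) \<in> S"
        unfolding S_def spM using u measurable_space[OF fst uV] by auto
      then show "x \<in> fst ` S" by force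
    qed
    have "y \<in> restrict_space X C \<rightarrow>\<^sub>M restrict_space baire D"
      using C(1) y(4) by (intro measurable_restrict_space2 measurable_restrict_space1)
        (auto simp: space_restrict_space)
    then have "(\<lambda>x. g (y x)) \<in> restrict_space X C \<rightarrow>\<^sub>M V"
      by (rule measurable_compose[OF _ g])
    moreover have "g (y x) = (x, snd (g (y x)))" if "x \<in> C" for x
      using C(2)[OF that] by (metis prod.collapse)
    ultimately show "(\<lambda>x. (x, snd (g (y x)))) \<in> restrict_space X C \<rightarrow>\<^sub>M V"
      by (subst measurable_cong[where g = "\<lambda>x. g (y x)"]) (auto simp: space_restrict_space)
    show "(x, snd (g (y x))) \<in> U" if "x \<in> C" for x
      using C(2,3)[OF that] by (metis prod.collapse)
  qed
qed

text \<open>Countably many exceptional null sets are discarded together, leaving one conull set on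
  which all sections are defined.\<close>

lemma borel_selections:
  fixes X :: "'x measure" and V :: "('x \<times> 'v) measure" and U :: "nat \<Rightarrow> ('x \<times> 'v) set"
  assumes X: "standard_borel X" "sigma_finite_measure X" and V: "standard_borel V"
    and fst: "fst \<in> V \<rightarrow>\<^sub>M X" and surj: "space X \<subseteq> fst ` space V" and U: "\<And>n. U n \<in> sets V"
  obtains X\<^sub>1 \<phi> where "X\<^sub>1 \<in> sets X" "space X - X\<^sub>1 \<in> null_sets X"
    "\<And>n::nat. (\<lambda>x. (x, \<phi> n x)) \<in> restrict_space X X\<^sub>1 \<rightarrow>\<^sub>M V"
    "\<And>n x. x \<in> X\<^sub>1 \<Longrightarrow> x \<in> fst ` U n \<Longrightarrow> (x, \<phi> n x) \<in> U n"
proof -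
  have sel: "\<exists>C N s. C \<in> sets X \<and> N \<in> null_sets X \<and> fst ` A \<subseteq> C \<union> N \<and>
      (\<lambda>x. (x, s x)) \<in> restrict_space X C \<rightarrow>\<^sub>M V \<and> (\<forall>x\<in>C. (x, s x) \<in> A)" if "A \<in> sets V" for A
    by (rule borel_selection[OF X V fst that]) blast
  from sel[OF sets.top] obtain C' N' s' where s': "C' \<in> sets X" "N' \<in> null_sets X"
      "fst ` space V \<subseteq> C' \<union> N'" "(\<lambda>x. (x, s' x)) \<in> restrict_space X C' \<rightarrow>\<^sub>M V"
    by blast
  from sel[OF U] have "\<forall>n. \<exists>C N s. C \<in> sets X \<and> N \<in> null_sets X \<and> fst ` U n \<subseteq> C \<union> N \<and>
      (\<lambda>x. (x, s x)) \<in> restrict_space X C \<rightarrow>\<^sub>M V \<and> (\<forall>x\<in>C. (x, s x) \<in> U n)"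
    by blast
  then obtain C N s where s: "\<forall>n. C n \<in> sets X \<and> N n \<in> null_sets X \<and> fst ` U n \<subseteq> C n \<union> N n \<and>
      (\<lambda>x. (x, s n x)) \<in> restrict_space X (C n) \<rightarrow>\<^sub>M V \<and> (\<forall>x\<in>C n. (x, s n x) \<in> U n)"
    unfolding choice_iff by blast
  define Z where "Z = N' \<union> (\<Union>n. N n)"
  have Z: "Z \<in> null_sets X"
    unfolding Z_def using s s'(2) by auto
  then have Z': "Z \<in> sets X" by auto
  \<comment> \<open>Off \<open>C n\<close> the value is taken from \<open>s'\<close>, a section of
    all of \<open>V\<close>. It is defined off \<open>N'\<close> because every fibre of
    \<open>V\<close> is nonempty.\<close>
  define \<phi> where "\<phi> n x = (if x \<in> C n then s n x else s' x)" for n x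
  show ?thesis
  proof (rule that[of "space X - Z" \<phi>])
    show "space X - Z \<in> sets X"
      using Z' by auto
    have "space X - (space X - Z) = Z"
      using sets.sets_into_space[OF Z'] by auto
    with Z show "space X - (space X - Z) \<in> null_sets X"
      by simp
    fix n
    let ?X = "restrict_space X (space X - Z)"
    have Cn: "C n \<in> sets X" using s by blast
    have "{x \<in> space ?X. x \<in> C n} = C n \<inter> (space X - Z)"
      using sets.sets_into_space[OF Cn] by (auto simp: space_restrict_space)
    also have "\<dots> \<in> sets ?X"
      using Cn Z' by (subst sets_restrict_space_iff) auto
    finally have set: "{x \<in> space ?X. x \<in> C n} \<in> sets ?X" .
    have "(\<lambda>x. if x \<in> C n then (x, s n x) else (x, s' x)) \<in> ?X \<rightarrow>\<^sub>M V"
      unfolding measurable_If_restrict_space_iff[OF set]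
    proof
      have "(\<lambda>x. (x, s n x)) \<in> restrict_space X (C n) \<rightarrow>\<^sub>M V"
        using s by blast
      then have "(\<lambda>x. (x, s n x)) \<in> restrict_space X ((space X - Z) \<inter> {x. x \<in> C n}) \<rightarrow>\<^sub>M V"
        by (rule measurable_restrict_mono) auto
      then show "(\<lambda>x. (x, s n x)) \<in> restrict_space ?X {x. x \<in> C n} \<rightarrow>\<^sub>M V"
        using Cn Z' by (subst restrict_restrict_space) auto
      have "(\<lambda>x. (x, s' x)) \<in> restrict_space X ((space X - Z) \<inter> {x. x \<notin> C n}) \<rightarrow>\<^sub>M V"
        using s'(4) by (rule measurable_restrict_mono) (use subset_trans[OF surj s'(3)] in \<open>auto simp: Z_def\<close>)
      moreover have "{x. x \<notin> C n} \<inter> space X \<in> sets X"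
      proof -
        have "{x. x \<notin> C n} \<inter> space X = space X - C n" by auto
        with Cn show ?thesis by simp
      qed
      ultimately show "(\<lambda>x. (x, s' x)) \<in> restrict_space ?X {x. x \<notin> C n} \<rightarrow>\<^sub>M V"
        using Z' by (subst restrict_restrict_space) auto
    qed
    moreover have "(\<lambda>x. (x, \<phi> n x)) = (\<lambda>x. if x \<in> C n then (x, s n x) else (x, s' x))"
      unfolding \<phi>_def by auto
    ultimately show "(\<lambda>x. (x, \<phi> n x)) \<in> ?X \<rightarrow>\<^sub>M V"
      by simp
    fix x assume "x \<in> space X - Z" "x \<in> fst ` U n"
    then have "x \<in> C n"
      using s unfolding Z_def by blast
    then show "(x, \<phi> n x) \<in> U n"
      unfolding \<phi>_def using s by simp
  qed
qed

section \<open>Fields of Polish spaces\<close>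

text \<open>For separability, one point of \<open>W\<close> is chosen in each ball
  \<open>mball (e i) (1 / Suc n)\<close> that meets \<open>W\<close>.\<close>

lemma polish_topology_closedin:
  assumes T: "polish_topology T" and W: "closedin T W"
  shows "polish_topology (subtopology T W)"
proof (cases "topspace T = {}")
  case True
  with W have "subtopology T W = T"
    by (metis closedin_subset subset_empty subtopology_topspace)
  with T show ?thesis by simp
next
  case False
  obtain d and e :: "nat \<Rightarrow> 'a" where "Metric_space (topspace T) d"
      and d: "Metric_space.mtopology (topspace T) d = T"
      and e: "\<And>i. e i \<in> topspace T" "\<And>x r. x \<in> topspace T \<Longrightarrow> 0 < r \<Longrightarrow> \<exists>i. d (e i) x < r"
    using polish_topology_metric[OF T False] by metis
  interpret Metric_space "topspace T" d by fact
  have "W \<subseteq> topspace T"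
    using W by (rule closedin_subset)
  define B where "B = (\<lambda>(i, n). W \<inter> mball (e i) (1 / Suc n))"
  define D where "D = (\<lambda>p. SOME w. w \<in> B p) ` {p. B p \<noteq> {}}"
  have some: "(SOME w. w \<in> B p) \<in> B p" if "B p \<noteq> {}" for p
    using that by (auto intro: someI)
  have "countable D"
    unfolding D_def by auto
  moreover have "D \<subseteq> topspace (subtopology T W)"
    using some \<open>W \<subseteq> topspace T\<close> unfolding D_def B_def by fastforce
  moreover have "subtopology T W closure_of D = topspace (subtopology T W)"
    unfolding dense_intersects_open
  proof (intro allI impI, elim conjE)
    fix S assume S: "openin (subtopology T W) S" "S \<noteq> {}"
    then obtain O' where O: "openin T O'" "S = O' \<inter> W"
      unfolding openin_subtopology by blast
    with S obtain x where x: "x \<in> O'" "x \<in> W" by blast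
    have "openin mtopology O'"
      using O d by simp
    then obtain r where r: "0 < r" "mball x r \<subseteq> O'"
      using x unfolding openin_mtopology by blast
    obtain n where n: "1 / Suc n < r / 2"
      using nat_approx_posE[of "r / 2"] r by auto
    have xT: "x \<in> topspace T"
      using x \<open>W \<subseteq> topspace T\<close> by blast
    obtain i where i: "d (e i) x < 1 / Suc n"
      using e(2)[OF xT, of "1 / Suc n"] by auto
    define w where "w = (SOME w. w \<in> B (i, n))"
    have "x \<in> B (i, n)"
      unfolding B_def using x xT e(1) i by (simp add: in_mball)
    then have "B (i, n) \<noteq> {}" by blast
    then have "w \<in> D" "w \<in> B (i, n)"
      unfolding D_def w_def using some by blast+
    then have w: "w \<in> W" "w \<in> topspace T" "d (e i) w < 1 / Suc n"
      unfolding B_def by (auto simp: in_mball)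
    have "d x w < r"
      using triangle[OF xT e(1) w(2), of i] commute[of x "e i"] i w(3) n by linarith
    then have "w \<in> O'"
      using r(2) xT w(2) by (auto simp: in_mball)
    with w(1) O(2) \<open>w \<in> D\<close> show "D \<inter> S \<noteq> {}" by blast
  qed
  ultimately have "separable_space (subtopology T W)"
    unfolding separable_space_def by blast
  with completely_metrizable_space_closedin[OF _ W] T show ?thesis
    unfolding polish_topology_def by blast
qed

lemma standard_borel_family_restrict:
  assumes V: "standard_borel_family X T V" and A: "A \<in> sets X"
  shows "standard_borel_family (restrict_space X A) T (restrict_space V (fst -` A))"
proof -
  have fst: "fst \<in> V \<rightarrow>\<^sub>M X" and sp: "space V = (SIGMA x:space X. topspace (T x))"
    using V unfolding standard_borel_family_def by auto
  have "standard_borel (restrict_space V (fst -` A))"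
    using V measurable_sets[OF fst A] unfolding standard_borel_family_def
    by (intro standard_borel_restrict) auto
  moreover have "fst \<in> restrict_space V (fst -` A) \<rightarrow>\<^sub>M restrict_space X A"
    by (intro measurable_restrict_space2 measurable_restrict_space1 fst) (auto simp: space_restrict_space)
  moreover have "space (restrict_space V (fst -` A)) = (SIGMA x:space (restrict_space X A). topspace (T x))"
    unfolding space_restrict_space sp by auto
  ultimately show ?thesis
    using V unfolding standard_borel_family_def by (auto simp: space_restrict_space)
qed

lemma standard_borel_family_closed:
  assumes V: "standard_borel_family X T V" and W: "\<And>x. x \<in> space X \<Longrightarrow> closedin (T x) (W x)"
    and "Sigma (space X) W \<in> sets V"
  shows "standard_borel_family X (\<lambda>x. subtopology (T x) (W x)) (restrict_space V (Sigma (space X) W))"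
proof -
  have fst: "fst \<in> V \<rightarrow>\<^sub>M X" and sp: "space V = (SIGMA x:space X. topspace (T x))"
    using V unfolding standard_borel_family_def by auto
  have "standard_borel V"
    using V unfolding standard_borel_family_def by blast
  then have "standard_borel (restrict_space V (Sigma (space X) W))"
    using assms(3) by (intro standard_borel_restrict) auto
  moreover have "fst \<in> restrict_space V (Sigma (space X) W) \<rightarrow>\<^sub>M X"
    by (intro measurable_restrict_space1 fst)
  moreover have "space (restrict_space V (Sigma (space X) W)) =
      (SIGMA x:space X. topspace (subtopology (T x) (W x)))"
    unfolding space_restrict_space sp by auto
  ultimately show ?thesis
    using V W polish_topology_closedin unfolding standard_borel_family_def by blast
qed

section \<open>Fibre metrics, dense sections and measured fields\<close>

lemma borel_fibre_metricD:
  assumes "borel_fibre_metric X T V d"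
  shows "(\<lambda>(v, w). d v w) \<in> borel_measurable (restrict_space (V \<Otimes>\<^sub>M V) {(v, w). fst v = fst w})"
    and "x \<in> space X \<Longrightarrow> Metric_space (topspace (T x)) (\<lambda>v w. d (x, v) (x, w))"
    and "x \<in> space X \<Longrightarrow> Metric_space.mcomplete (topspace (T x)) (\<lambda>v w. d (x, v) (x, w))"
    and "x \<in> space X \<Longrightarrow> separable_space (Metric_space.mtopology (topspace (T x)) (\<lambda>v w. d (x, v) (x, w)))"
    and "x \<in> space X \<Longrightarrow> Metric_space.mtopology (topspace (T x)) (\<lambda>v w. d (x, v) (x, w)) = T x"
  using assms unfolding borel_fibre_metric_def Let_def by auto

text \<open>This covers both closed subfamilies and restriction of the base; for the latter
  \<open>W x\<close> is taken to be all of \<open>topspace (T x)\<close>. Completeness and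
  separability pass to closed subsets.\<close>

lemma borel_fibre_metric_closed:
  assumes d: "borel_fibre_metric X T V d" and X': "space X' \<subseteq> space X"
    and V': "(\<lambda>v. v) \<in> V' \<rightarrow>\<^sub>M V" and W: "\<And>x. x \<in> space X' \<Longrightarrow> closedin (T x) (W x)"
  shows "borel_fibre_metric X' (\<lambda>x. subtopology (T x) (W x)) V' d"
  unfolding borel_fibre_metric_def Let_def
proof (intro conjI ballI)
  have "(\<lambda>p. (fst p, snd p)) \<in> V' \<Otimes>\<^sub>M V' \<rightarrow>\<^sub>M V \<Otimes>\<^sub>M V"
    using V' by (intro measurable_Pair measurable_compose[OF _ V']) auto
  then have "(\<lambda>p. p) \<in> restrict_space (V' \<Otimes>\<^sub>M V') {(v, w). fst v = fst w}
      \<rightarrow>\<^sub>M restrict_space (V \<Otimes>\<^sub>M V) {(v, w). fst v = fst w}"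
    by (intro measurable_restrict_space2 measurable_restrict_space1) (auto simp: space_restrict_space)
  from measurable_compose[OF this borel_fibre_metricD(1)[OF d]]
  show "(\<lambda>(v, w). d v w) \<in> borel_measurable (restrict_space (V' \<Otimes>\<^sub>M V') {(v, w). fst v = fst w})" .
  fix x assume x': "x \<in> space X'"
  with X' have x: "x \<in> space X" by blast
  note d = borel_fibre_metricD(2-5)[OF d x]
  interpret Metric_space "topspace (T x)" "\<lambda>v w. d (x, v) (x, w)"
    by (rule d)
  have sub: "W x \<subseteq> topspace (T x)"
    using W[OF x'] by (rule closedin_subset)
  then have W_eq: "topspace (subtopology (T x) (W x)) = W x"
    by auto
  interpret Submetric "topspace (T x)" "\<lambda>v w. d (x, v) (x, w)" "W x"
    by unfold_locales (rule sub)
  have "polish_topology (T x)"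
    using d Metric_space_axioms unfolding polish_topology_def completely_metrizable_space_def by metis
  then have "separable_space (subtopology (T x) (W x))"
    using polish_topology_closedin[OF _ W[OF x']] unfolding polish_topology_def by blast
  moreover have top: "sub.mtopology = subtopology (T x) (W x)"
    using mtopology_submetric d(4) by simp
  ultimately show "separable_space (Metric_space.mtopology (topspace (subtopology (T x) (W x)))
      (\<lambda>v w. d (x, v) (x, w)))"
    unfolding W_eq by simp
  show "Metric_space.mtopology (topspace (subtopology (T x) (W x))) (\<lambda>v w. d (x, v) (x, w)) =
      subtopology (T x) (W x)"
    unfolding W_eq by (rule top)
  show "Metric_space (topspace (subtopology (T x) (W x))) (\<lambda>v w. d (x, v) (x, w))"
    unfolding W_eq by (rule sub.Metric_space_axioms)
  show "Metric_space.mcomplete (topspace (subtopology (T x) (W x))) (\<lambda>v w. d (x, v) (x, w))"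
    unfolding W_eq using W[OF x'] d by (intro closedin_mcomplete_imp_mcomplete) auto
qed

lemma measured_field_polishI:
  fixes X :: "'x measure" and U :: "nat \<Rightarrow> ('x \<times> 'v) set"
  assumes X: "standard_borel X" "sigma_finite_measure X" and V: "standard_borel_family X T V"
    and ne: "\<And>x. x \<in> space X \<Longrightarrow> topspace (T x) \<noteq> {}"
    and X\<^sub>0: "X\<^sub>0 \<in> sets X" "space X - X\<^sub>0 \<in> null_sets X"
    and d: "borel_fibre_metric (restrict_space X X\<^sub>0) T (restrict_space V (fst -` X\<^sub>0)) d"
    and U: "\<And>n. U n \<in> sets V"
    and base: "\<And>x S. x \<in> X\<^sub>0 \<Longrightarrow> openin (T x) S \<Longrightarrow> S \<noteq> {} \<Longrightarrow>
      \<exists>n. Pair x -` U n \<noteq> {} \<and> Pair x -` U n \<subseteq> S"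
  shows "measured_field_polish X T V"
proof -
  have fst: "fst \<in> V \<rightarrow>\<^sub>M X" and spV: "space V = (SIGMA x:space X. topspace (T x))"
      and sbV: "standard_borel V"
    using V unfolding standard_borel_family_def by auto
  have surj: "space X \<subseteq> fst ` space V"
  proof
    fix x assume "x \<in> space X"
    moreover from this obtain v where "v \<in> topspace (T x)"
      using ne by blast
    ultimately show "x \<in> fst ` space V"
      unfolding spV by (intro image_eqI[of _ _ "(x, v)"]) auto
  qed
  obtain X\<^sub>1 \<phi> where X\<^sub>1: "X\<^sub>1 \<in> sets X" "space X - X\<^sub>1 \<in> null_sets X"
      and \<phi>: "\<And>n. (\<lambda>x. (x, \<phi> n x)) \<in> restrict_space X X\<^sub>1 \<rightarrow>\<^sub>M V"
      "\<And>n x. x \<in> X\<^sub>1 \<Longrightarrow> x \<in> fst ` U n \<Longrightarrow> (x, \<phi> n x) \<in> U n"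
    by (rule borel_selections[where U = U, OF X sbV fst surj U]) (rule that)
  \<comment> \<open>Over \<open>X\<^sub>0\<close> the metric and the sets \<open>U n\<close> behave
    well, over \<open>X\<^sub>1\<close> the sections exist.\<close>
  define Y where "Y = X\<^sub>0 \<inter> X\<^sub>1"
  have Y: "Y \<in> sets X" "Y \<subseteq> space X"
    unfolding Y_def using X\<^sub>0 X\<^sub>1 sets.sets_into_space[OF X\<^sub>0(1)] by auto
  have "space X - Y = (space X - X\<^sub>0) \<union> (space X - X\<^sub>1)"
    unfolding Y_def by auto
  with X\<^sub>0(2) X\<^sub>1(2) have null: "emeasure X (space X - Y) = 0"
    by (metis null_sets.Un null_setsD1)
  have "standard_borel (restrict_space X Y)"
    using Y by (intro standard_borel_restrict X) auto
  moreover have "borel_fibre_metric (restrict_space X Y) (\<lambda>x. subtopology (T x) (topspace (T x)))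
      (restrict_space V (fst -` Y)) d"
  proof (rule borel_fibre_metric_closed[OF d])
    show "(\<lambda>v. v) \<in> restrict_space V (fst -` Y) \<rightarrow>\<^sub>M restrict_space V (fst -` X\<^sub>0)"
      by (intro measurable_restrict_space3 measurable_ident) (auto simp: Y_def)
  qed (auto simp: space_restrict_space Y_def)
  moreover have "dense_borel_sections (restrict_space X Y) T (restrict_space V (fst -` Y)) \<phi>"
    unfolding dense_borel_sections_def
  proof (intro conjI allI ballI)
    show "(\<lambda>x. (x, \<phi> n x)) \<in> restrict_space X Y \<rightarrow>\<^sub>M restrict_space V (fst -` Y)" for n
      by (intro measurable_restrict_space2 measurable_restrict_mono[OF \<phi>(1)])
        (auto simp: Y_def space_restrict_space)
    fix x assume "x \<in> space (restrict_space X Y)"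
    then have x: "x \<in> X\<^sub>0" "x \<in> X\<^sub>1"
      by (auto simp: space_restrict_space Y_def)
    show "T x closure_of range (\<lambda>n. \<phi> n x) = topspace (T x)"
      unfolding dense_intersects_open
    proof (intro allI impI, elim conjE)
      fix S assume "openin (T x) S" "S \<noteq> {}"
      then obtain n where n: "Pair x -` U n \<noteq> {}" "Pair x -` U n \<subseteq> S"
        using base[OF x(1)] by blast
      then have "x \<in> fst ` U n" by force
      then have "\<phi> n x \<in> S"
        using \<phi>(2)[OF x(2)] n(2) by blast
      then show "range (\<lambda>n. \<phi> n x) \<inter> S \<noteq> {}" by blast
    qed
  qed
  ultimately have "borel_field_polish (restrict_space X Y) T (restrict_space V (fst -` Y))"
    using standard_borel_family_restrict[OF V Y(1)] unfolding borel_field_polish_def by auto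
  with X V Y(1) null show ?thesis
    unfolding measured_field_polish_def by blast
qed

lemma measured_field_polish_of_base:
  fixes X :: "'x measure" and U :: "nat \<Rightarrow> ('x \<times> 'v) set"
  assumes X: "standard_borel X" "sigma_finite_measure X" and V: "standard_borel_family X T V"
    and ne: "\<And>x. x \<in> space X \<Longrightarrow> topspace (T x) \<noteq> {}"
    and d: "borel_fibre_metric X T V d" and U: "\<And>n. U n \<in> sets V"
    and base: "\<And>x. x \<in> space X \<Longrightarrow>
      openin (T x) = arbitrary union_of (\<lambda>S. S \<in> {Pair x -` U n | n. True})"
  shows "measured_field_polish X T V"
proof (rule measured_field_polishI[OF X V ne sets.top _ _ U])
  have "borel_fibre_metric (restrict_space X (space X)) (\<lambda>x. subtopology (T x) (topspace (T x)))
      (restrict_space V (fst -` space X)) d"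
    by (rule borel_fibre_metric_closed[OF d]) (auto simp: space_restrict_space intro!: measurable_restrict_space1)
  then show "borel_fibre_metric (restrict_space X (space X)) T (restrict_space V (fst -` space X)) d"
    by simp
  fix x S assume "x \<in> space X" "openin (T x) S" "S \<noteq> {}"
  then obtain \<U> where "\<U> \<subseteq> {Pair x -` U n | n. True}" "\<Union>\<U> = S"
    using base by (auto simp: union_of_def)
  \<comment> \<open>A nonempty union of basic sets has a nonempty member, which lies in
    \<open>S\<close>.\<close>
  with \<open>S \<noteq> {}\<close> show "\<exists>n. Pair x -` U n \<noteq> {} \<and> Pair x -` U n \<subseteq> S"
    by blast
qed auto

lemma measured_field_polish_closed:
  fixes X :: "'x measure" and W :: "'x \<Rightarrow> 'v set"
  assumes V: "measured_field_polish X T V"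
    and W: "\<And>x. x \<in> space X \<Longrightarrow> W x \<noteq> {}" "\<And>x. x \<in> space X \<Longrightarrow> closedin (T x) (W x)"
    and WV: "Sigma (space X) W \<in> sets V"
  shows "measured_field_polish X (\<lambda>x. subtopology (T x) (W x)) (restrict_space V (Sigma (space X) W))"
proof -
  let ?V' = "restrict_space V (Sigma (space X) W)"
  obtain X\<^sub>0 where X: "standard_borel X" "sigma_finite_measure X" and fam: "standard_borel_family X T V"
      and X\<^sub>0: "X\<^sub>0 \<in> sets X" "emeasure X (space X - X\<^sub>0) = 0"
      and field: "borel_field_polish (restrict_space X X\<^sub>0) T (restrict_space V (fst -` X\<^sub>0))"
    using V unfolding measured_field_polish_def by blast
  let ?V\<^sub>0 = "restrict_space V (fst -` X\<^sub>0)"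
  obtain d \<phi> where d: "borel_fibre_metric (restrict_space X X\<^sub>0) T ?V\<^sub>0 d"
      and \<phi>: "dense_borel_sections (restrict_space X X\<^sub>0) T ?V\<^sub>0 \<phi>"
    using field unfolding borel_field_polish_def by blast
  have fst: "fst \<in> V \<rightarrow>\<^sub>M X" and spV: "space V = (SIGMA x:space X. topspace (T x))"
    using fam unfolding standard_borel_family_def by auto
  have sub: "X\<^sub>0 \<subseteq> space X"
    using sets.sets_into_space[OF X\<^sub>0(1)] .
  have WsubT: "W x \<subseteq> topspace (T x)" if "x \<in> space X" for x
    using W(2)[OF that] by (rule closedin_subset)
  have fstV0: "fst \<in> ?V\<^sub>0 \<rightarrow>\<^sub>M restrict_space X X\<^sub>0"
    by (intro measurable_restrict_space2 measurable_restrict_space1 fst) (auto simp: space_restrict_space)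
  define f where "f n v = d (fst v, \<phi> n (fst v)) v" for n v
  have f: "f n \<in> borel_measurable ?V\<^sub>0" for n
  proof -
    have "(\<lambda>x. (x, \<phi> n x)) \<in> restrict_space X X\<^sub>0 \<rightarrow>\<^sub>M ?V\<^sub>0"
      using \<phi> unfolding dense_borel_sections_def by blast
    then have "(\<lambda>v. ((fst v, \<phi> n (fst v)), v)) \<in> ?V\<^sub>0 \<rightarrow>\<^sub>M ?V\<^sub>0 \<Otimes>\<^sub>M ?V\<^sub>0"
      by (intro measurable_Pair measurable_compose[OF fstV0]) auto
    then have "(\<lambda>v. ((fst v, \<phi> n (fst v)), v)) \<in>
        ?V\<^sub>0 \<rightarrow>\<^sub>M restrict_space (?V\<^sub>0 \<Otimes>\<^sub>M ?V\<^sub>0) {(v, w). fst v = fst w}"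
      by (intro measurable_restrict_space2) auto
    from measurable_compose[OF this borel_fibre_metricD(1)[OF d]] show ?thesis
      unfolding f_def by simp
  qed
  \<comment> \<open>\<open>k\<close> codes a section \<open>n\<close> and a radius
    \<open>1 / Suc m\<close>. The centres \<open>\<phi> n x\<close> need not lie in
    \<open>W x\<close>, so the sections themselves cannot be used for \<open>W\<close>; the points
    of \<open>W\<close> near them form Borel sets to select from.\<close>
  define U where "U k = {v \<in> space ?V\<^sub>0. f (fst (prod_decode k)) v < 1 / Suc (snd (prod_decode k))}
      \<inter> Sigma (space X) W" for k
  have U: "U k \<in> sets ?V'" for k
  proof -
    have "{v \<in> space ?V\<^sub>0. f (fst (prod_decode k)) v < 1 / Suc (snd (prod_decode k))} \<in> sets ?V\<^sub>0"
      using f by measurable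
    then have "{v \<in> space ?V\<^sub>0. f (fst (prod_decode k)) v < 1 / Suc (snd (prod_decode k))} \<in> sets V"
      using measurable_sets[OF fst X\<^sub>0(1)] by (subst (asm) sets_restrict_space_iff) auto
    with WV show ?thesis
      unfolding U_def by (subst sets_restrict_space_iff) auto
  qed
  show ?thesis
  proof (rule measured_field_polishI[OF X standard_borel_family_closed[OF fam W(2) WV] _ X\<^sub>0(1) _ _ U])
    show "space X - X\<^sub>0 \<in> null_sets X"
      using X\<^sub>0 by auto
    show "topspace (subtopology (T x) (W x)) \<noteq> {}" if "x \<in> space X" for x
      using W(1)[OF that] WsubT[OF that] by auto
    show "borel_fibre_metric (restrict_space X X\<^sub>0) (\<lambda>x. subtopology (T x) (W x))
        (restrict_space ?V' (fst -` X\<^sub>0)) d"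
    proof (rule borel_fibre_metric_closed[OF d order_refl])
      show "(\<lambda>v. v) \<in> restrict_space ?V' (fst -` X\<^sub>0) \<rightarrow>\<^sub>M ?V\<^sub>0"
        by (intro measurable_restrict_space2 measurable_restrict_space1 measurable_ident)
          (auto simp: space_restrict_space)
    qed (use W(2) in \<open>auto simp: space_restrict_space\<close>)
    fix x S assume x: "x \<in> X\<^sub>0" and S: "openin (subtopology (T x) (W x)) S" "S \<noteq> {}"
    have xX: "x \<in> space X" "x \<in> space (restrict_space X X\<^sub>0)"
      using x sub by (auto simp: space_restrict_space)
    interpret Metric_space "topspace (T x)" "\<lambda>v w. d (x, v) (x, w)"
      by (rule borel_fibre_metricD(2)[OF d xX(2)])
    obtain O' where O: "openin (T x) O'" "S = O' \<inter> W x"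
      using S unfolding openin_subtopology by blast
    with S obtain s where s: "s \<in> O'" "s \<in> W x" by blast
    then have sT: "s \<in> topspace (T x)"
      using WsubT[OF xX(1)] by blast
    have "openin mtopology O'"
      using O borel_fibre_metricD(5)[OF d xX(2)] by simp
    then obtain r where r: "0 < r" "mball s r \<subseteq> O'"
      using s unfolding openin_mtopology by blast
    \<comment> \<open>Half of \<open>r\<close>, because both \<open>s\<close> and any other point of
      the chosen ball are within \<open>1 / Suc m\<close> of its centre.\<close>
    obtain m where m: "1 / Suc m < r / 2"
      using nat_approx_posE[of "r / 2"] r by auto
    have "s \<in> T x closure_of range (\<lambda>n. \<phi> n x)"
      using \<phi> xX(2) sT unfolding dense_borel_sections_def by blast
    then have "s \<in> mtopology closure_of range (\<lambda>n. \<phi> n x)"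
      using borel_fibre_metricD(5)[OF d xX(2)] by simp
    then obtain n where n: "\<phi> n x \<in> topspace (T x)" "d (x, s) (x, \<phi> n x) < 1 / Suc m"
      unfolding metric_closure_of by (auto simp: in_mball dest!: spec[of _ "1 / Suc m"])
    have U_iff: "w \<in> Pair x -` U (prod_encode (n, m)) \<longleftrightarrow> w \<in> W x \<and> d (x, \<phi> n x) (x, w) < 1 / Suc m" for w
      unfolding U_def f_def using xX(1) x WsubT[OF xX(1)] by (auto simp: space_restrict_space spV)
    have "s \<in> Pair x -` U (prod_encode (n, m))"
      unfolding U_iff using s n commute[of s "\<phi> n x"] by simp
    moreover have "w \<in> S" if "w \<in> Pair x -` U (prod_encode (n, m))" for w
    proof -
      have w: "w \<in> W x" "d (x, \<phi> n x) (x, w) < 1 / Suc m"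
        using that unfolding U_iff by auto
      then have wT: "w \<in> topspace (T x)"
        using WsubT[OF xX(1)] by blast
      have "d (x, s) (x, w) < r"
        using triangle[OF sT n(1) wT] n(2) w(2) m by linarith
      with sT wT have "w \<in> mball s r"
        by (simp add: in_mball)
      with r w O show "w \<in> S" by blast
    qed
    ultimately show "\<exists>k. Pair x -` U k \<noteq> {} \<and> Pair x -` U k \<subseteq> S"
      by (intro exI[of _ "prod_encode (n, m)"]) blast
  qed
qed

theorem proposition3p2:
  fixes X :: "'x measure" and T :: "'x \<Rightarrow> 'v topology" and V :: "('x \<times> 'v) measure"
  shows
    "(standard_borel X \<and> sigma_finite_measure X \<and>
      (\<forall>x\<in>space X. topspace (T x) \<noteq> {}) \<and>
      standard_borel_family X T V \<and>
      (\<exists>d. borel_fibre_metric X T V d) \<and>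
      (\<exists>U :: nat \<Rightarrow> ('x \<times> 'v) set. (\<forall>n. U n \<in> sets V) \<and>
         (\<forall>x\<in>space X. openin (T x) = arbitrary union_of (\<lambda>S. S \<in> {Pair x -` U n | n. True})))
      \<longrightarrow> measured_field_polish X T V)
     \<and>
     (measured_field_polish X T V \<longrightarrow>
      (\<forall>W :: 'x \<Rightarrow> 'v set.
         (\<forall>x\<in>space X. W x \<noteq> {} \<and> closedin (T x) (W x)) \<and>
         (SIGMA x:space X. W x) \<in> sets V
         \<longrightarrow> measured_field_polish X (\<lambda>x. subtopology (T x) (W x))
               (restrict_space V (SIGMA x:space X. W x))))"
  (is "(?hyp \<longrightarrow> ?field) \<and> (?field \<longrightarrow> ?closed)")
proof (intro conjI impI allI)
  assume ?hyp
  then obtain d U where "standard_borel X" "sigma_finite_measure X" "standard_borel_family X T V"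
      "\<forall>x\<in>space X. topspace (T x) \<noteq> {}" "borel_fibre_metric X T V d"
      "\<forall>n :: nat. U n \<in> sets V"
      "\<forall>x\<in>space X. openin (T x) = arbitrary union_of (\<lambda>S. S \<in> {Pair x -` U n | n. True})"
    by (elim conjE exE)
  then show ?field
    by (intro measured_field_polish_of_base[of X T V d U]) auto
next
  fix W :: "'x \<Rightarrow> 'v set"
  assume ?field "(\<forall>x\<in>space X. W x \<noteq> {} \<and> closedin (T x) (W x)) \<and> Sigma (space X) W \<in> sets V"
  then show "measured_field_polish X (\<lambda>x. subtopology (T x) (W x)) (restrict_space V (Sigma (space X) W))"
    by (intro measured_field_polish_closed) auto
qed

end
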